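(* Let $X$ be a connected topological space, $p:Y\to X$ a Galois cover and $G=\operatorname{Aut}(Y|X)$ the group of automorphisms of $p$. If $q:Z\to X$ is a connected cover such that $p=q\circ f$ for a continuous map $f:Y\to Z$, then $f$ is a Galois cover and $Z\cong Y/H$, where $H=\operatorname{Aut}(Y|Z)$ is a subgroup of $G$. The maps $H\mapsto Y/H$ and $Z\mapsto\operatorname{Aut}(Y|Z)$ induce a bijection between the subgroups of $G$ and the (isomorphism classes of) intermediate covers $Z$ as described. The cover $q:Z\to X$ is Galois if and only if $H=\operatorname{Aut}(Y|Z)$ is a normal subgroup of $G$, and in that case $\operatorname{Aut}(Z|X)\cong G/H$.
   Context: All topological spaces are assumed locally path-connected and semi-locally simply-connected. A cover of $X$ is a space $Y$ with a continuous map $p:Y\to X$ such that every $x\in X$ has a neighbourhood $U$ with $p^{-1}(U)=\bigsqcup_{y\in p^{-1}(x)}V_y$, each $V_y$ open (with $y\in V_y$) and mapped homeomorphically onto $U$ by $p$. A cover is connected if the covering space is connected. $\operatorname{Aut}(Y|X)$ is the group of homeomorphisms $d:Y\to Y$ with $p\circ d=p$. A cover $p:Y\to X$ is Galois if $Y$ is connected and the induced map $Y/\operatorname{Aut}(Y|X)\to X$ is a homeomorphism. Intermediate covers are pairs $(q:Z\to X,\ f:Y\to Z)$ with $Z$ connected, $q$ a cover and $p=q\circ f$, considered up to isomorphism compatible with the maps from $Y$ and to $X$. *)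

theory Defs
  imports "HOL-Analysis.Analysis" "HOL-Algebra.Bij" "HOL-Algebra.Coset" "HOL-Algebra.Group_Action"
begin

definition semilocally_simply_connected_space :: "'a topology \<Rightarrow> bool" where
  "semilocally_simply_connected_space X \<longleftrightarrow>
     (\<forall>x\<in>topspace X. \<exists>U. openin X U \<and> x \<in> U \<and>
        (\<forall>g. pathin (subtopology X U) g \<and> g 0 = x \<and> g 1 = x \<longrightarrow>
             homotopic_with (\<lambda>h. h 0 = x \<and> h 1 = x) (top_of_set {0..1}) X g (\<lambda>t. x)))"

definition admissible_space :: "'a topology \<Rightarrow> bool" where
  "admissible_space X \<longleftrightarrow> locally_path_connected_space X \<and> semilocally_simply_connected_space X"

text \<open>Fibres are allowed to be empty, as in the usual evenly-covered definition.
  Maps are total functions of which only the values on the topspace matter.\<close>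

definition covering_map :: "'a topology \<Rightarrow> 'b topology \<Rightarrow> ('a \<Rightarrow> 'b) \<Rightarrow> bool" where
  "covering_map Y X p \<longleftrightarrow>
     continuous_map Y X p \<and>
     (\<forall>x\<in>topspace X. \<exists>U V. openin X U \<and> x \<in> U \<and>
        {y \<in> topspace Y. p y \<in> U} = (\<Union>y\<in>{y \<in> topspace Y. p y = x}. V y) \<and>
        disjoint_family_on V {y \<in> topspace Y. p y = x} \<and>
        (\<forall>y\<in>{y \<in> topspace Y. p y = x}.
            openin Y (V y) \<and> y \<in> V y \<and>
            homeomorphic_map (subtopology Y (V y)) (subtopology X U) p))"

text \<open>The automorphism group of a cover \<open>p\<close> of some space by \<open>Y\<close>. Automorphisms are taken to be
  extensional (\<open>undefined\<close> off the topspace), so that equal homeomorphisms are equal as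
  functions; the product is composition on the topspace.\<close>

definition deck_group :: "'a topology \<Rightarrow> ('a \<Rightarrow> 'b) \<Rightarrow> ('a \<Rightarrow> 'a) monoid" where
  "deck_group Y p = BijGroup (topspace Y)
     \<lparr>carrier := {d \<in> extensional (topspace Y).
                   homeomorphic_map Y Y d \<and> (\<forall>y\<in>topspace Y. p (d y) = p y)}\<rparr>"

definition quotient_topology :: "'a topology \<Rightarrow> ('a \<Rightarrow> 'b) \<Rightarrow> 'b topology" where
  "quotient_topology Y r =
     topology (\<lambda>U. U \<subseteq> r ` topspace Y \<and> openin Y {y \<in> topspace Y. r y \<in> U})"

lemma openin_quotient_topology:
  "openin (quotient_topology Y r) U \<longleftrightarrow>
     U \<subseteq> r ` topspace Y \<and> openin Y {y \<in> topspace Y. r y \<in> U}"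
proof -
  have "istopology (\<lambda>U. U \<subseteq> r ` topspace Y \<and> openin Y {y \<in> topspace Y. r y \<in> U})"
    unfolding istopology_def
  proof (intro conjI allI impI)
    fix S T
    assume S: "S \<subseteq> r ` topspace Y \<and> openin Y {y \<in> topspace Y. r y \<in> S}"
      and T: "T \<subseteq> r ` topspace Y \<and> openin Y {y \<in> topspace Y. r y \<in> T}"
    show "S \<inter> T \<subseteq> r ` topspace Y" using S by blast
    have "{y \<in> topspace Y. r y \<in> S \<inter> T} =
        {y \<in> topspace Y. r y \<in> S} \<inter> {y \<in> topspace Y. r y \<in> T}" by blast
    moreover have "openin Y ({y \<in> topspace Y. r y \<in> S} \<inter> {y \<in> topspace Y. r y \<in> T})"
      by (rule openin_Int) (rule conjunct2[OF S], rule conjunct2[OF T])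
    ultimately show "openin Y {y \<in> topspace Y. r y \<in> S \<inter> T}" by (rule ssubst)
  next
    fix K
    assume K: "\<forall>S\<in>K. S \<subseteq> r ` topspace Y \<and> openin Y {y \<in> topspace Y. r y \<in> S}"
    show "\<Union>K \<subseteq> r ` topspace Y" using K by blast
    have "{y \<in> topspace Y. r y \<in> \<Union>K} = (\<Union>S\<in>K. {y \<in> topspace Y. r y \<in> S})" by blast
    moreover have "openin Y (\<Union>S\<in>K. {y \<in> topspace Y. r y \<in> S})"
      by (rule openin_Union, erule imageE) (use K in simp)
    ultimately show "openin Y {y \<in> topspace Y. r y \<in> \<Union>K}" by (rule ssubst)
  qed
  then show ?thesis unfolding quotient_topology_def by (simp add: topology_inverse')
qed

lemma topspace_quotient_topology: "topspace (quotient_topology Y r) = r ` topspace Y"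
proof
  show "topspace (quotient_topology Y r) \<subseteq> r ` topspace Y"
    using openin_topspace[of "quotient_topology Y r"]
    unfolding openin_quotient_topology by (rule conjunct1)
  have "{y \<in> topspace Y. r y \<in> r ` topspace Y} = topspace Y" by blast
  then have "openin (quotient_topology Y r) (r ` topspace Y)"
    by (simp add: openin_quotient_topology)
  then show "r ` topspace Y \<subseteq> topspace (quotient_topology Y r)"
    by (rule openin_subset)
qed

lemma quotient_map_quotient_topology: "quotient_map Y (quotient_topology Y r) r"
  by (auto simp: quotient_map_def topspace_quotient_topology openin_quotient_topology)

text \<open>\<open>orbit_map Y H y\<close> is the set of all \<open>h y\<close> with \<open>h \<in> H\<close>, for a set \<open>H\<close> of self-maps of \<open>Y\<close>.\<close>

definition orbit_map :: "'a topology \<Rightarrow> ('a \<Rightarrow> 'a) set \<Rightarrow> 'a \<Rightarrow> 'a set" where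
  "orbit_map Y H = orbit (BijGroup (topspace Y)\<lparr>carrier := H\<rparr>) (\<lambda>h. h)"

definition orbit_space :: "'a topology \<Rightarrow> ('a \<Rightarrow> 'a) set \<Rightarrow> 'a set topology" where
  "orbit_space Y H = quotient_topology Y (orbit_map Y H)"

text \<open>The map on orbits induced by a map that is constant on each orbit.\<close>

definition induced_map :: "('a \<Rightarrow> 'b) \<Rightarrow> 'a set \<Rightarrow> 'b" where
  "induced_map p S = the_elem (p ` S)"

definition galois_cover :: "'a topology \<Rightarrow> 'b topology \<Rightarrow> ('a \<Rightarrow> 'b) \<Rightarrow> bool" where
  "galois_cover Y X p \<longleftrightarrow>
     covering_map Y X p \<and> connected_space Y \<and>
     homeomorphic_map (orbit_space Y (carrier (deck_group Y p))) X (induced_map p)"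

text \<open>An intermediate cover of \<open>p : Y \<rightarrow> X\<close> is a triple \<open>(Z, q, f)\<close> with \<open>q : Z \<rightarrow> X\<close> and
  \<open>f : Y \<rightarrow> Z\<close>.\<close>

definition intermediate_covers ::
    "'y topology \<Rightarrow> 'x topology \<Rightarrow> ('y \<Rightarrow> 'x) \<Rightarrow> ('z topology \<times> ('z \<Rightarrow> 'x) \<times> ('y \<Rightarrow> 'z)) set" where
  "intermediate_covers Y X p =
     {(Z, q, f). admissible_space Z \<and> connected_space Z \<and> covering_map Z X q \<and>
                 continuous_map Y Z f \<and> (\<forall>y\<in>topspace Y. p y = q (f y))}"

definition iso_intermediate ::
    "'y topology \<Rightarrow> 'z topology \<times> ('z \<Rightarrow> 'x) \<times> ('y \<Rightarrow> 'z) \<Rightarrow>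
     'w topology \<times> ('w \<Rightarrow> 'x) \<times> ('y \<Rightarrow> 'w) \<Rightarrow> bool" where
  "iso_intermediate Y = (\<lambda>(Z, q, f) (Z', q', f').
     \<exists>\<phi>. homeomorphic_map Z Z' \<phi> \<and>
         (\<forall>y\<in>topspace Y. \<phi> (f y) = f' y) \<and> (\<forall>z\<in>topspace Z. q' (\<phi> z) = q z))"

definition iso_rel ::
    "'y topology \<Rightarrow> 'x topology \<Rightarrow> ('y \<Rightarrow> 'x) \<Rightarrow>
     (('z topology \<times> ('z \<Rightarrow> 'x) \<times> ('y \<Rightarrow> 'z)) \<times> ('z topology \<times> ('z \<Rightarrow> 'x) \<times> ('y \<Rightarrow> 'z))) set" where
  "iso_rel Y X p = {(c, c'). c \<in> intermediate_covers Y X p \<and> c' \<in> intermediate_covers Y X p \<and>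
                             iso_intermediate Y c c'}"

definition quotient_cover ::
    "'y topology \<Rightarrow> ('y \<Rightarrow> 'x) \<Rightarrow> ('y \<Rightarrow> 'y) set \<Rightarrow>
     'y set topology \<times> ('y set \<Rightarrow> 'x) \<times> ('y \<Rightarrow> 'y set)" where
  "quotient_cover Y p H = (orbit_space Y H, induced_map p, orbit_map Y H)"

definition Aut_over :: "'y topology \<Rightarrow> 'z topology \<times> ('z \<Rightarrow> 'x) \<times> ('y \<Rightarrow> 'z) \<Rightarrow> ('y \<Rightarrow> 'y) set" where
  "Aut_over Y = (\<lambda>(Z, q, f). carrier (deck_group Y f))"

lemma iso_intermediate_refl: "iso_intermediate Y c c"
  by (cases c) (auto simp: iso_intermediate_def intro: exI[of _ id])

lemma iso_intermediate_trans:
  assumes "iso_intermediate Y a b" "iso_intermediate Y b c"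
  shows "iso_intermediate Y a c"
proof -
  obtain Z q f Z' q' f' Z'' q'' f'' where t: "a = (Z, q, f)" "b = (Z', q', f')" "c = (Z'', q'', f'')"
    by (metis prod_cases3)
  obtain \<phi> \<psi> where \<phi>: "homeomorphic_map Z Z' \<phi>" "\<forall>y\<in>topspace Y. \<phi> (f y) = f' y"
      "\<forall>z\<in>topspace Z. q' (\<phi> z) = q z"
    and \<psi>: "homeomorphic_map Z' Z'' \<psi>" "\<forall>y\<in>topspace Y. \<psi> (f' y) = f'' y"
      "\<forall>z\<in>topspace Z'. q'' (\<psi> z) = q' z"
    using assms unfolding t iso_intermediate_def by auto
  have "\<phi> z \<in> topspace Z'" if "z \<in> topspace Z" for z
    using \<phi>(1) that homeomorphic_imp_surjective_map by blast
  then show ?thesis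
    unfolding t iso_intermediate_def using \<phi> \<psi> homeomorphic_map_compose[OF \<phi>(1) \<psi>(1)]
    by (auto intro!: exI[of _ "\<psi> \<circ> \<phi>"])
qed

lemma iso_intermediate_sym:
  assumes "iso_intermediate Y (Z, q, f) (Z', q', f')" and "f ` topspace Y \<subseteq> topspace Z"
  shows "iso_intermediate Y (Z', q', f') (Z, q, f)"
proof -
  obtain \<phi> where \<phi>: "homeomorphic_map Z Z' \<phi>" "\<forall>y\<in>topspace Y. \<phi> (f y) = f' y"
      "\<forall>z\<in>topspace Z. q' (\<phi> z) = q z"
    using assms unfolding iso_intermediate_def by auto
  then obtain \<psi> where \<psi>: "homeomorphic_maps Z Z' \<phi> \<psi>"
    using homeomorphic_map_maps by blast
  have "homeomorphic_map Z' Z \<psi>"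
    using \<psi> homeomorphic_maps_map by blast
  moreover have "\<psi> (f' y) = f y" if "y \<in> topspace Y" for y
    using \<psi> \<phi>(2) assms(2) that unfolding homeomorphic_maps_def by (metis image_subset_iff)
  moreover have "q (\<psi> z) = q' z" if "z \<in> topspace Z'" for z
  proof -
    have "\<psi> z \<in> topspace Z" "\<phi> (\<psi> z) = z"
      using \<psi> that unfolding homeomorphic_maps_def continuous_map_def by auto
    then show ?thesis using \<phi>(3) by metis
  qed
  ultimately show ?thesis unfolding iso_intermediate_def by auto
qed

lemma equiv_iso_rel:
  fixes Y :: "'y topology" and X :: "'x topology"
  shows "equiv (intermediate_covers Y X p :: ('z topology \<times> ('z \<Rightarrow> 'x) \<times> ('y \<Rightarrow> 'z)) set)
     (iso_rel Y X p)" (is "equiv ?I ?R")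
proof (rule equivI)
  show "?R \<subseteq> ?I \<times> ?I"
    by (auto simp: iso_rel_def)
  show "refl_on ?I ?R"
    by (auto simp: refl_on_def iso_rel_def intro: iso_intermediate_refl)
  show "sym ?R"
  proof (rule symI)
    fix c c' :: "'z topology \<times> ('z \<Rightarrow> 'x) \<times> ('y \<Rightarrow> 'z)"
    assume *: "(c, c') \<in> ?R"
    obtain Z q f Z' q' f' where t: "c = (Z, q, f)" "c' = (Z', q', f')"
      by (metis prod_cases3)
    have "f ` topspace Y \<subseteq> topspace Z"
      using * unfolding t iso_rel_def intermediate_covers_def continuous_map_def by auto
    then show "(c', c) \<in> ?R"
      using * iso_intermediate_sym unfolding t iso_rel_def by blast
  qed
  show "trans ?R"
    by (auto simp: trans_def iso_rel_def intro: iso_intermediate_trans)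
qed

lemma subgroup_deck_group: "subgroup (carrier (deck_group Y p)) (BijGroup (topspace Y))"
proof -
  let ?S = "topspace Y" and ?C = "carrier (deck_group Y p)"
  interpret B: group "BijGroup ?S" by (rule group_BijGroup)
  have C: "?C = {d \<in> extensional ?S. homeomorphic_map Y Y d \<and> (\<forall>y\<in>?S. p (d y) = p y)}"
    by (simp add: deck_group_def)
  have Bij: "d \<in> Bij ?S" if "d \<in> ?C" for d
    using that homeomorphic_imp_surjective_map[of Y Y d] homeomorphic_imp_injective_map[of Y Y d]
    by (simp add: C Bij_def bij_betw_def)
  have img: "d y \<in> ?S" if "d \<in> ?C" "y \<in> ?S" for d y
    using Bij[OF that(1)] that(2) by (auto simp: Bij_def bij_betw_def)
  have cong: "homeomorphic_map Y Y g"
    if "homeomorphic_map Y Y h" "\<And>y. y \<in> ?S \<Longrightarrow> h y = g y" for h g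
    using homeomorphic_map_eq[OF that(1)] that(2) by blast
  show ?thesis
  proof
    show "?C \<subseteq> carrier (BijGroup ?S)" using Bij by (auto simp: BijGroup_def)
    show "\<one>\<^bsub>BijGroup ?S\<^esub> \<in> ?C"
      using cong[of id "\<lambda>x\<in>?S. x"] by (simp add: C BijGroup_def)
  next
    fix d e assume d: "d \<in> ?C" and e: "e \<in> ?C"
    have "homeomorphic_map Y Y (compose ?S d e)"
      by (rule cong[OF homeomorphic_map_compose[of Y Y e Y d]])
        (use d e in \<open>simp_all add: C compose_def\<close>)
    moreover have "d \<otimes>\<^bsub>BijGroup ?S\<^esub> e = compose ?S d e"
      using Bij d e by (simp add: BijGroup_def)
    ultimately show "d \<otimes>\<^bsub>BijGroup ?S\<^esub> e \<in> ?C"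
      using d e img[OF e] by (simp add: C compose_def)
  next
    fix d assume d: "d \<in> ?C"
    have inv: "inv\<^bsub>BijGroup ?S\<^esub> d = (\<lambda>x\<in>?S. (inv_into ?S d) x)"
      using Bij[OF d] by (rule inv_BijGroup)
    have bij: "bij_betw d ?S ?S" using Bij[OF d] by (auto simp: Bij_def)
    have "homeomorphic_map Y Y d" using d by (simp add: C)
    then obtain e where "homeomorphic_maps Y Y d e"
      unfolding homeomorphic_map_maps by (rule exE)
    then have e: "homeomorphic_map Y Y e" "\<forall>y\<in>?S. d (e y) = y"
      unfolding homeomorphic_maps_map by blast+
    have eq: "e y = inv_into ?S d y" if "y \<in> ?S" for y
    proof -
      have "e y \<in> ?S" using homeomorphic_imp_surjective_map[OF e(1)] that by blast
      then show ?thesis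
        using e(2) that bij inv_into_f_eq[of d ?S "e y" y] by (simp add: bij_betw_def)
    qed
    note e(1)
    then have "homeomorphic_map Y Y (\<lambda>x\<in>?S. (inv_into ?S d) x)"
      by (rule cong) (simp add: eq)
    moreover have "p (inv_into ?S d y) = p y" if "y \<in> ?S" for y
    proof -
      have "y \<in> d ` ?S" using that bij by (simp add: bij_betw_def)
      then have "inv_into ?S d y \<in> ?S" "d (inv_into ?S d y) = y"
        by (rule inv_into_into, rule f_inv_into_f)
      moreover have "\<forall>x\<in>?S. p (d x) = p x" using d by (simp add: C)
      ultimately show ?thesis by metis
    qed
    ultimately show "inv\<^bsub>BijGroup ?S\<^esub> d \<in> ?C"
      unfolding inv by (simp add: C)
  qed
qed

lemma group_deck_group: "group (deck_group Y p)"
proof -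
  have "deck_group Y p = BijGroup (topspace Y)\<lparr>carrier := carrier (deck_group Y p)\<rparr>"
    by (simp add: deck_group_def)
  then show ?thesis
    using subgroup.subgroup_is_group[OF subgroup_deck_group group_BijGroup] by metis
qed

end

theory Submission
  imports Defs
begin

text \<open>Over a connected evenly covered open set, a continuous map between two covers of \<open>X\<close> sends sheets
  bijectively to sheets; hence every map \<open>f : Y \<rightarrow> Z\<close> over \<open>X\<close> is itself a covering map, and two
  lifts that agree at one point of a connected space agree everywhere. A cover is Galois iff it is a
  connected surjective cover whose deck group is transitive on fibres. If \<open>f y = f y'\<close>, a deck
  transformation of \<open>p\<close> taking \<open>y\<close> to \<open>y'\<close> preserves \<open>f\<close> by uniqueness of lifts, so \<open>f\<close> is Galois and
  \<open>Z\<close> is \<open>Y/H\<close>. Conversely a subgroup \<open>H\<close> permutes the sheets of \<open>p\<close>, so the orbit space covers \<open>X\<close>,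
  and uniqueness of lifts shows that its group over \<open>Y\<close> is \<open>H\<close> again.\<close>

section \<open>Sheets and lifts\<close>

text \<open>\<open>U\<close> is evenly covered and \<open>V y\<close> is the sheet through the point \<open>y\<close> of the fibre over \<open>x\<close>.
  Each sheet is only required to map bijectively onto \<open>U\<close>: openness of the covering map makes
  these bijections homeomorphisms.\<close>

definition sheets ::
    "'a topology \<Rightarrow> 'b topology \<Rightarrow> ('a \<Rightarrow> 'b) \<Rightarrow> 'b \<Rightarrow> 'b set \<Rightarrow> ('a \<Rightarrow> 'a set) \<Rightarrow> bool" where
  "sheets Y X p x U V \<longleftrightarrow>
     openin X U \<and> x \<in> U \<and>
     (\<forall>v\<in>topspace Y. p v \<in> U \<longrightarrow> (\<exists>y\<in>topspace Y. p y = x \<and> v \<in> V y)) \<and>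
     (\<forall>y\<in>topspace Y. \<forall>y'\<in>topspace Y. p y = x \<longrightarrow> p y' = x \<longrightarrow> V y \<inter> V y' \<noteq> {} \<longrightarrow> y = y') \<and>
     (\<forall>y\<in>topspace Y. p y = x \<longrightarrow> openin Y (V y) \<and> y \<in> V y \<and> inj_on p (V y) \<and> p ` V y = U)"

lemma sheetsD:
  assumes "sheets Y X p x U V"
  shows "openin X U" and "x \<in> U"
    and "\<lbrakk>v \<in> topspace Y; p v \<in> U\<rbrakk> \<Longrightarrow> \<exists>y\<in>topspace Y. p y = x \<and> v \<in> V y"
    and "\<lbrakk>y \<in> topspace Y; y' \<in> topspace Y; p y = x; p y' = x; v \<in> V y; v \<in> V y'\<rbrakk> \<Longrightarrow> y = y'"
    and "\<lbrakk>y \<in> topspace Y; p y = x\<rbrakk> \<Longrightarrow> openin Y (V y)"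
    and "\<lbrakk>y \<in> topspace Y; p y = x\<rbrakk> \<Longrightarrow> y \<in> V y"
    and "\<lbrakk>y \<in> topspace Y; p y = x\<rbrakk> \<Longrightarrow> inj_on p (V y)"
    and "\<lbrakk>y \<in> topspace Y; p y = x\<rbrakk> \<Longrightarrow> p ` V y = U"
    and "\<lbrakk>y \<in> topspace Y; p y = x; v \<in> V y\<rbrakk> \<Longrightarrow> v \<in> topspace Y"
proof -
  show sub: "openin X U" "x \<in> U" "\<lbrakk>y \<in> topspace Y; p y = x\<rbrakk> \<Longrightarrow> openin Y (V y)"
    "\<lbrakk>y \<in> topspace Y; p y = x\<rbrakk> \<Longrightarrow> y \<in> V y"
    "\<lbrakk>y \<in> topspace Y; p y = x\<rbrakk> \<Longrightarrow> inj_on p (V y)"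
    "\<lbrakk>y \<in> topspace Y; p y = x\<rbrakk> \<Longrightarrow> p ` V y = U"
    using assms by (simp_all add: sheets_def)
  show "\<lbrakk>v \<in> topspace Y; p v \<in> U\<rbrakk> \<Longrightarrow> \<exists>y\<in>topspace Y. p y = x \<and> v \<in> V y"
    using assms by (simp add: sheets_def)
  show "\<lbrakk>y \<in> topspace Y; y' \<in> topspace Y; p y = x; p y' = x; v \<in> V y; v \<in> V y'\<rbrakk> \<Longrightarrow> y = y'"
    using assms unfolding sheets_def by blast
  show "\<lbrakk>y \<in> topspace Y; p y = x; v \<in> V y\<rbrakk> \<Longrightarrow> v \<in> topspace Y"
    using sub(3) openin_subset by blast
qed

text \<open>Recovers the homeomorphism clause of \<open>covering_map\<close> from the bare
  bijectivity recorded in \<open>sheets\<close>: an open continuous bijection between open sets is a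
  homeomorphism.\<close>

lemma homeomorphic_map_open_restriction:
  assumes "continuous_map Y X p" "open_map Y X p" "openin Y V" "openin X U" "inj_on p V" "p ` V = U"
  shows "homeomorphic_map (subtopology Y V) (subtopology X U) p"
proof (rule bijective_open_imp_homeomorphic_map)
  have sub: "V \<subseteq> topspace Y" "U \<subseteq> topspace X"
    using assms openin_subset by auto
  have top: "topspace (subtopology Y V) = V" "topspace (subtopology X U) = U"
    using sub by auto
  show "continuous_map (subtopology Y V) (subtopology X U) p"
    using assms(1,6) sub
    by (auto simp: continuous_map_in_subtopology continuous_map_from_subtopology)
  show "open_map (subtopology Y V) (subtopology X U) p"
    unfolding open_map_def
  proof (intro allI impI)
    fix W assume "openin (subtopology Y V) W"
    then have W: "openin Y W" "W \<subseteq> V"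
      using openin_open_subtopology[OF assms(3)] by auto
    then have "openin X (p ` W)" using assms(2) open_map_def by blast
    then show "openin (subtopology X U) (p ` W)"
      using W assms(6) openin_open_subtopology[OF assms(4)] by auto
  qed
  show "p ` topspace (subtopology Y V) = topspace (subtopology X U)" "inj_on p (topspace (subtopology Y V))"
    using assms top by auto
qed

text \<open>Openness is local: the part of \<open>W\<close> inside the sheet through
  \<open>y\<close> is carried by a homeomorphism to an open subset of an open
  \<open>U\<close>.\<close>

lemma covering_map_open_map:
  assumes "covering_map Y X p"
  shows "open_map Y X p"
  unfolding open_map_def
proof (intro allI impI)
  fix W assume W: "openin Y W"
  show "openin X (p ` W)"
  proof (subst openin_subopen, intro ballI)
    fix x assume "x \<in> p ` W"
    then obtain y where y: "y \<in> W" "x = p y" by auto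
    have yY: "y \<in> topspace Y" using W y openin_subset by blast
    then have "x \<in> topspace X"
      using assms y unfolding covering_map_def continuous_map_def by auto
    then obtain U V where UV: "openin X U" "openin Y (V y)" "y \<in> V y"
        "homeomorphic_map (subtopology Y (V y)) (subtopology X U) p"
      using assms y yY unfolding covering_map_def by fastforce
    have "openin (subtopology Y (V y)) (W \<inter> V y)"
      using W UV by (simp add: openin_open_subtopology openin_Int)
    then have "openin (subtopology X U) (p ` (W \<inter> V y))"
      using UV(4) homeomorphic_imp_open_map open_map_def by blast
    then have "openin X (p ` (W \<inter> V y))"
      using UV(1) openin_open_subtopology by blast
    then show "\<exists>T. openin X T \<and> x \<in> T \<and> T \<subseteq> p ` W"
      using y UV(3) by (intro exI[of _ "p ` (W \<inter> V y)"]) auto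
  qed
qed

text \<open>The working form of the definition. Openness is recorded once for \<open>p\<close>, so a
  proof that some map is a cover only has to treat its sheets as sets.\<close>

lemma covering_map_iff_sheets:
  "covering_map Y X p \<longleftrightarrow>
     continuous_map Y X p \<and> open_map Y X p \<and> (\<forall>x\<in>topspace X. \<exists>U V. sheets Y X p x U V)"
  (is "?L \<longleftrightarrow> ?R")
proof
  assume L: ?L
  have "\<exists>U V. sheets Y X p x U V" if x: "x \<in> topspace X" for x
  proof -
    let ?F = "{y \<in> topspace Y. p y = x}"
    obtain U V where UV: "openin X U" "x \<in> U"
        "{y \<in> topspace Y. p y \<in> U} = (\<Union>y\<in>?F. V y)"
        "disjoint_family_on V ?F"
        "\<And>y. y \<in> ?F \<Longrightarrow> openin Y (V y) \<and> y \<in> V y \<and>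
            homeomorphic_map (subtopology Y (V y)) (subtopology X U) p"
      using L x unfolding covering_map_def by meson
    have "inj_on p (V y) \<and> p ` V y = U" if "y \<in> ?F" for y
    proof -
      have "V y \<subseteq> topspace Y" "U \<subseteq> topspace X"
        using UV(1) UV(5)[OF that] openin_subset by auto
      then show ?thesis
        using UV(5)[OF that] homeomorphic_imp_injective_map homeomorphic_imp_surjective_map
        by (metis topspace_subtopology_subset)
    qed
    then have "sheets Y X p x U V"
      unfolding sheets_def using UV by (auto simp: disjoint_family_on_def) blast+
    then show ?thesis by blast
  qed
  then show ?R
    using L covering_map_open_map unfolding covering_map_def by blast
next
  assume R: ?R
  show ?L
    unfolding covering_map_def
  proof (intro conjI ballI)
    show "continuous_map Y X p" using R by blast
    fix x assume "x \<in> topspace X"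
    then obtain U V where UV: "sheets Y X p x U V" using R by blast
    note S = sheetsD[OF UV]
    have "homeomorphic_map (subtopology Y (V y)) (subtopology X U) p"
      if "y \<in> topspace Y" "p y = x" for y
      using R S that by (intro homeomorphic_map_open_restriction) auto
    moreover have "{y \<in> topspace Y. p y \<in> U} = (\<Union>y\<in>{y \<in> topspace Y. p y = x}. V y)"
      using S(3,8,9) by blast
    moreover have "disjoint_family_on V {y \<in> topspace Y. p y = x}"
      using S(4) unfolding disjoint_family_on_def by blast
    ultimately show "\<exists>U V. openin X U \<and> x \<in> U \<and>
        {y \<in> topspace Y. p y \<in> U} = (\<Union>y\<in>{y \<in> topspace Y. p y = x}. V y) \<and>
        disjoint_family_on V {y \<in> topspace Y. p y = x} \<and>
        (\<forall>y\<in>{y \<in> topspace Y. p y = x}.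
            openin Y (V y) \<and> y \<in> V y \<and>
            homeomorphic_map (subtopology Y (V y)) (subtopology X U) p)"
      using S(1,2,5,6) by (intro exI[of _ U] exI[of _ V]) simp
  qed
qed

section \<open>Choosing small and connected evenly covered neighbourhoods\<close>

lemma covering_map_continuous_map: "covering_map Y X p \<Longrightarrow> continuous_map Y X p"
  by (simp add: covering_map_def)

lemma covering_map_sheets:
  assumes "covering_map Y X p" "x \<in> topspace X"
  obtains U V where "sheets Y X p x U V"
  using assms by (auto simp: covering_map_iff_sheets)

text \<open>Trimming every sheet to the part over \<open>U'\<close> keeps it bijective onto its
  image. This allows \<open>U\<close> to be made connected, or common to two covers.\<close>

lemma sheets_restrict:
  assumes UV: "sheets Y X p x U V" and p: "continuous_map Y X p"
    and U': "openin X U'" "x \<in> U'" "U' \<subseteq> U"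
  shows "sheets Y X p x U' (\<lambda>y. {v \<in> V y. p v \<in> U'})"
proof -
  note S = sheetsD[OF UV]
  have "openin Y {v \<in> V y. p v \<in> U'}" if "y \<in> topspace Y" "p y = x" for y
  proof -
    have "{v \<in> V y. p v \<in> U'} = V y \<inter> {v \<in> topspace Y. p v \<in> U'}"
      using S(9)[OF that] by auto
    then show ?thesis
      using S(5)[OF that] openin_continuous_map_preimage[OF p U'(1)] by auto
  qed
  moreover have "inj_on p {v \<in> V y. p v \<in> U'}" if "y \<in> topspace Y" "p y = x" for y
    using S(7)[OF that] by (rule inj_on_subset) auto
  moreover have "p ` {v \<in> V y. p v \<in> U'} = U'" if "y \<in> topspace Y" "p y = x" for y
    using S(8)[OF that] U'(3) by auto
  ultimately show ?thesis
    using S(3,4,6) U' unfolding sheets_def by (auto; blast)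
qed

lemma sheet_connectedin:
  assumes "covering_map Y X p" "sheets Y X p x U V" "connectedin X U" "y \<in> topspace Y" "p y = x"
  shows "connectedin Y (V y)"
proof -
  note S = sheetsD[OF assms(2)]
  have hom: "homeomorphic_map (subtopology Y (V y)) (subtopology X U) p"
    using assms S by (intro homeomorphic_map_open_restriction) (auto simp: covering_map_iff_sheets)
  have "V y \<subseteq> topspace (subtopology Y (V y))"
    using S(5)[OF assms(4,5)] openin_subset by force
  from homeomorphic_map_connectedness[OF hom this] show ?thesis
    using assms S(8) by simp
qed

lemma connected_sheets:
  assumes "locally_path_connected_space X" "covering_map Y X p" "openin X N" "x \<in> N"
  obtains U V where "sheets Y X p x U V" "connectedin X U" "U \<subseteq> N"
proof -
  have "x \<in> topspace X" using assms openin_subset by blast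
  then obtain U V where UV: "sheets Y X p x U V"
    using covering_map_sheets[OF assms(2)] by blast
  have "openin X (U \<inter> N)" "x \<in> U \<inter> N" using sheetsD(1,2)[OF UV] assms by auto
  then obtain U' where U': "openin X U'" "path_connectedin X U'" "x \<in> U'" "U' \<subseteq> U \<inter> N"
    using assms(1) unfolding locally_path_connected_space by meson
  have "sheets Y X p x U' (\<lambda>y. {v \<in> V y. p v \<in> U'})"
    using sheets_restrict[OF UV covering_map_continuous_map[OF assms(2)]] U' by blast
  then show ?thesis
    using that path_connectedin_imp_connectedin[OF U'(2)] U'(4) by blast
qed

text \<open>An evenly covered set for \<open>q\<close> is chosen first, a connected one for
  \<open>p\<close> is found inside it, and the sheets of \<open>q\<close> are then trimmed to
  match.\<close>

lemma connected_sheets2: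
  assumes "locally_path_connected_space X" "covering_map Y X p" "covering_map Z X q" "x \<in> topspace X"
  obtains U V W where "sheets Y X p x U V" "sheets Z X q x U W" "connectedin X U"
proof -
  obtain U0 W0 where W0: "sheets Z X q x U0 W0"
    using covering_map_sheets[OF assms(3,4)] .
  obtain U V where UV: "sheets Y X p x U V" "connectedin X U" "U \<subseteq> U0"
    using connected_sheets[OF assms(1,2) sheetsD(1,2)[OF W0]] .
  then show ?thesis
    using sheets_restrict[OF W0 covering_map_continuous_map[OF assms(3)] sheetsD(1,2)[OF UV(1)]] that
    by blast
qed

text \<open>The image of a connected sheet is connected, so it stays in a single sheet of \<open>q\<close>; it fills that
  sheet because both project onto \<open>U\<close>.\<close>

lemma lift_sheet_image:
  assumes p: "covering_map Y X p" and q: "covering_map Z X q"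
    and V: "sheets Y X p x U V" and W: "sheets Z X q x U W" and U: "connectedin X U"
    and f: "continuous_map Y Z f" and qf: "\<And>y. y \<in> topspace Y \<Longrightarrow> q (f y) = p y"
    and y: "y \<in> topspace Y" "p y = x"
  shows "f ` V y = W (f y)"
proof -
  note SV = sheetsD[OF V] and SW = sheetsD[OF W]
  have fY: "f v \<in> topspace Z" if "v \<in> topspace Y" for v
    using f that by (auto simp: continuous_map_def)
  define z where "z = f y"
  have z: "z \<in> topspace Z" "q z = x" using fY qf y by (auto simp: z_def)
  \<comment> \<open>\<open>B\<close> collects the other sheets of \<open>q\<close>. It is open and
    disjoint from \<open>W z\<close>, and together they contain the image of \<open>V y\<close>, so
    connectedness keeps that image in the one containing \<open>z\<close>.\<close>
  define B where "B = (\<Union>z'\<in>{z' \<in> topspace Z. q z' = x \<and> z' \<noteq> z}. W z')"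
  have con: "connectedin Z (f ` V y)"
    using connectedin_continuous_map_image[OF f sheet_connectedin[OF p V U y]] .
  have "openin Z B" unfolding B_def using SW(5) by blast
  moreover have "f ` V y \<subseteq> W z \<union> B"
  proof
    fix w assume "w \<in> f ` V y"
    then obtain v where v: "v \<in> V y" "w = f v" by auto
    then have "v \<in> topspace Y" "p v \<in> U" using SV(8,9) y by auto
    then have "w \<in> topspace Z" "q w \<in> U" using v fY qf by auto
    from SW(3)[OF this] show "w \<in> W z \<union> B" unfolding B_def by blast
  qed
  moreover have "W z \<inter> B = {}" unfolding B_def using SW(4) z by blast
  moreover have "z \<in> W z" "z \<in> f ` V y" using SW(6)[OF z] SV(6)[OF y] z_def by auto
  ultimately have "B \<inter> f ` V y = {}"
    using connectedinD[OF con SW(5)[OF z], of B] by blast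
  then have sub: "f ` V y \<subseteq> W z" using \<open>f ` V y \<subseteq> W z \<union> B\<close> by blast
  have "W z \<subseteq> f ` V y"
  proof
    fix w assume w: "w \<in> W z"
    then have "q w \<in> p ` V y" using SW(8)[OF z] SV(8)[OF y] by auto
    then obtain v where v: "v \<in> V y" "q w = p v" by auto
    then have "q (f v) = q w" "f v \<in> W z" using qf SV(9)[OF y] sub by auto
    then have "f v = w" using SW(7)[OF z] w by (auto dest: inj_onD)
    then show "w \<in> f ` V y" using v by auto
  qed
  with sub show ?thesis by (simp add: z_def)
qed

section \<open>Maps over the base between two covers\<close>

lemma lift_open_map:
  assumes X: "locally_path_connected_space X"
    and p: "covering_map Y X p" and q: "covering_map Z X q"
    and f: "continuous_map Y Z f" and qf: "\<And>y. y \<in> topspace Y \<Longrightarrow> q (f y) = p y"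
  shows "open_map Y Z f"
  unfolding open_map_def
proof (intro allI impI)
  fix T assume T: "openin Y T"
  have fY: "f v \<in> topspace Z" if "v \<in> topspace Y" for v
    using f that by (auto simp: continuous_map_def)
  show "openin Z (f ` T)"
  proof (subst openin_subopen, intro ballI)
    fix z assume "z \<in> f ` T"
    then obtain y where y: "y \<in> T" "z = f y" by auto
    have yY: "y \<in> topspace Y" using T y openin_subset by blast
    define x where "x = p y"
    have x: "x \<in> topspace X" "q z = x"
      using p yY qf y unfolding covering_map_def continuous_map_def x_def by auto
    obtain U V W where V: "sheets Y X p x U V" and W: "sheets Z X q x U W" and U: "connectedin X U"
      using connected_sheets2[OF X p q x(1)] .
    note SV = sheetsD[OF V] and SW = sheetsD[OF W]
    have zZ: "z \<in> topspace Z" using fY yY y by simp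
    have fV: "f ` V y = W z"
      using lift_sheet_image[OF p q V W U f qf yY] x_def y by auto
    define T' where "T' = T \<inter> V y"
    have T': "openin Y T'" using T SV(5) yY x_def T'_def by auto
    have "openin X (p ` T')"
      using covering_map_open_map[OF p] T' by (simp add: open_map_def)
    then have "openin Z (W z \<inter> {w \<in> topspace Z. q w \<in> p ` T'})"
      using SW(5)[OF zZ x(2)] q openin_continuous_map_preimage unfolding covering_map_def by blast
    \<comment> \<open>On the sheet \<open>V y\<close>, \<open>f\<close> is \<open>p\<close> followed
      by the inverse of \<open>q\<close> on \<open>W z\<close>. Hence the image of \<open>T'\<close>
      is the part of \<open>W z\<close> lying over the open set of values of \<open>p\<close> on
      \<open>T'\<close>.\<close>
    moreover have "W z \<inter> {w \<in> topspace Z. q w \<in> p ` T'} = f ` T'"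
    proof
      show "W z \<inter> {w \<in> topspace Z. q w \<in> p ` T'} \<subseteq> f ` T'"
      proof
        fix w assume w: "w \<in> W z \<inter> {w \<in> topspace Z. q w \<in> p ` T'}"
        then obtain v where v: "v \<in> T'" "q w = p v" by auto
        then have "v \<in> V y" by (simp add: T'_def)
        then have "f v \<in> W z" "q (f v) = q w"
          using fV qf SV(9)[OF yY] v x_def by auto
        then have "f v = w" using SW(7)[OF zZ x(2)] w by (auto dest: inj_onD)
        then show "w \<in> f ` T'" using v by auto
      qed
      show "f ` T' \<subseteq> W z \<inter> {w \<in> topspace Z. q w \<in> p ` T'}"
        using fV qf fY openin_subset[OF T'] by (fastforce simp: T'_def)
    qed
    ultimately have "openin Z (f ` T')" by simp
    moreover have "z \<in> f ` T'" using y SV(6)[OF yY] by (auto simp: T'_def x_def)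
    ultimately show "\<exists>S. openin Z S \<and> z \<in> S \<and> S \<subseteq> f ` T"
      by (intro exI[of _ "f ` T'"]) (auto simp: T'_def)
  qed
qed

text \<open>The sheets of \<open>p\<close> over \<open>q z\<close> serve again as sheets of
  \<open>f\<close>, but only those through points of the fibre of \<open>f\<close> over
  \<open>z\<close>, and the evenly covered set is the sheet \<open>W z\<close> of
  \<open>q\<close>.\<close>

lemma lift_covering_map:
  assumes X: "locally_path_connected_space X"
    and p: "covering_map Y X p" and q: "covering_map Z X q"
    and f: "continuous_map Y Z f" and qf: "\<And>y. y \<in> topspace Y \<Longrightarrow> q (f y) = p y"
  shows "covering_map Y Z f"
  unfolding covering_map_iff_sheets
proof (intro conjI ballI)
  show "continuous_map Y Z f" by (rule f)
  show "open_map Y Z f" using lift_open_map[OF X p q f qf] .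
  fix z assume z: "z \<in> topspace Z"
  define x where "x = q z"
  have x: "x \<in> topspace X"
    using q z unfolding covering_map_def continuous_map_def x_def by auto
  obtain U V W where V: "sheets Y X p x U V" and W: "sheets Z X q x U W" and U: "connectedin X U"
    using connected_sheets2[OF X p q x] .
  note SV = sheetsD[OF V] and SW = sheetsD[OF W]
  have fY: "f v \<in> topspace Z" if "v \<in> topspace Y" for v
    using f that by (auto simp: continuous_map_def)
  have fV: "f ` V y = W (f y)" if "y \<in> topspace Y" "p y = x" for y
    using lift_sheet_image[OF p q V W U f qf that] .
  have fib: "p y = x" if "y \<in> topspace Y" "f y = z" for y
    using qf that x_def by metis
  have "sheets Y Z f z (W z) V"
    unfolding sheets_def
  proof (intro conjI ballI impI)
    show "openin Z (W z)" "z \<in> W z" using SW(5,6) z x_def by auto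
  next
    fix v assume v: "v \<in> topspace Y" "f v \<in> W z"
    then have "p v \<in> U" using SW(8)[OF z] qf x_def by force
    then obtain y where y: "y \<in> topspace Y" "p y = x" "v \<in> V y" using SV(3) v by blast
    then have "f v \<in> W (f y)" using fV by blast
    moreover have "f y \<in> topspace Z" "q (f y) = x" using fY qf y by auto
    \<comment> \<open>\<open>f v\<close> lies both in the sheet through \<open>f y\<close> and in
      the sheet through \<open>z\<close>, and distinct sheets over \<open>x\<close> are
      disjoint.\<close>
    ultimately have "f y = z" using SW(4)[of "f y" z] v(2) z x_def[symmetric] by blast
    then show "\<exists>y\<in>topspace Y. f y = z \<and> v \<in> V y" using y by blast
  next
    fix y y' assume "y \<in> topspace Y" "y' \<in> topspace Y" "f y = z" "f y' = z" "V y \<inter> V y' \<noteq> {}"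
    then show "y = y'" using SV(4) fib by blast
  next
    fix y assume y: "y \<in> topspace Y" "f y = z"
    note y' = y(1) fib[OF y]
    show "openin Y (V y)" "y \<in> V y" "f ` V y = W z" using SV(5,6) fV y' y by auto
    show "inj_on f (V y)"
    proof (rule inj_onI)
      fix a b assume ab: "a \<in> V y" "b \<in> V y" "f a = f b"
      then have "p a = p b" using qf SV(9)[OF y'] by metis
      then show "a = b" using SV(7)[OF y'] ab by (auto dest: inj_onD)
    qed
  qed
  then show "\<exists>U V. sheets Y Z f z U V" by blast
qed

text \<open>The image is open, and so is its complement: an evenly covered set that meets the image
  has a nonempty fibre over its centre. A point of \<open>Y\<close> is required because the empty
  space covers every space.\<close>

lemma lift_surjective:
  assumes X: "locally_path_connected_space X"
    and p: "covering_map Y X p" and q: "covering_map Z X q"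
    and f: "continuous_map Y Z f" and qf: "\<And>y. y \<in> topspace Y \<Longrightarrow> q (f y) = p y"
    and Z: "connected_space Z" and Y: "topspace Y \<noteq> {}"
  shows "f ` topspace Y = topspace Z"
proof -
  have cov: "covering_map Y Z f" using lift_covering_map[OF X p q f qf] .
  then have op: "openin Z (f ` topspace Y)"
    using covering_map_open_map open_map_def openin_topspace by blast
  have "openin Z (topspace Z - f ` topspace Y)"
  proof (subst openin_subopen, intro ballI)
    fix z assume z: "z \<in> topspace Z - f ` topspace Y"
    then obtain U V where "sheets Y Z f z U V" using covering_map_sheets[OF cov] by blast
    note S = sheetsD[OF this]
    have "U \<inter> f ` topspace Y = {}" using S(3) z by blast
    then show "\<exists>T. openin Z T \<and> z \<in> T \<and> T \<subseteq> topspace Z - f ` topspace Y"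
      using S(1,2) openin_subset[OF S(1)] by blast
  qed
  from connected_spaceD[OF Z op this] show ?thesis
    using Y openin_subset[OF op] by auto
qed

text \<open>The set where \<open>f\<close> and \<open>g\<close> agree is open and closed. Two equal
  values share a sheet on which \<open>q\<close> is injective; two different values over the same
  point of \<open>X\<close> lie in disjoint sheets. Thus no Hausdorff condition enters.\<close>

lemma lifts_eq:
  assumes q: "covering_map Z X q" and Y: "connected_space Y"
    and f: "continuous_map Y Z f" and g: "continuous_map Y Z g"
    and eq: "\<And>y. y \<in> topspace Y \<Longrightarrow> q (f y) = q (g y)"
    and y0: "y0 \<in> topspace Y" "f y0 = g y0" and y: "y \<in> topspace Y"
  shows "f y = g y"
proof -
  define A where "A = {y \<in> topspace Y. f y = g y}"
  have fZ: "f y \<in> topspace Z" and gZ: "g y \<in> topspace Z" if "y \<in> topspace Y" for y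
    using f g that by (auto simp: continuous_map_def)
  have pre: "openin Y {y \<in> topspace Y. f y \<in> S \<and> g y \<in> T}" if "openin Z S" "openin Z T" for S T
  proof -
    have "{y \<in> topspace Y. f y \<in> S \<and> g y \<in> T} =
        {y \<in> topspace Y. f y \<in> S} \<inter> {y \<in> topspace Y. g y \<in> T}" by blast
    then show ?thesis
      using openin_Int[OF openin_continuous_map_preimage[OF f that(1)]
          openin_continuous_map_preimage[OF g that(2)]] by simp
  qed
  have *: "\<exists>S T. openin Z S \<and> openin Z T \<and> f y \<in> S \<and> g y \<in> T \<and>
      (if f y = g y then S = T \<and> inj_on q S else S \<inter> T = {})" if y: "y \<in> topspace Y" for y
  proof -
    have "q (f y) \<in> topspace X" using q fZ[OF y] by (auto simp: covering_map_def continuous_map_def)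
    then obtain U V where "sheets Z X q (q (f y)) U V" using covering_map_sheets[OF q] by blast
    note S = sheetsD[OF this]
    have 1: "openin Z (V (f y))" "f y \<in> V (f y)" "inj_on q (V (f y))"
      using S(5,6,7) fZ[OF y] by auto
    have 2: "openin Z (V (g y))" "g y \<in> V (g y)"
      using S(5,6) gZ[OF y] eq[OF y] by auto
    have "V (f y) \<inter> V (g y) = {}" if "f y \<noteq> g y"
      using S(4) fZ[OF y] gZ[OF y] eq[OF y] that by fastforce
    then show ?thesis using 1 2 by (intro exI[of _ "V (f y)"] exI[of _ "V (g y)"]) auto
  qed
  have "openin Y A"
  proof (subst openin_subopen, intro ballI)
    fix y assume "y \<in> A"
    then have y: "y \<in> topspace Y" "f y = g y" by (auto simp: A_def)
    obtain S where S: "openin Z S" "f y \<in> S" "inj_on q S" using *[OF y(1)] y(2) by auto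
    have "{y \<in> topspace Y. f y \<in> S \<and> g y \<in> S} \<subseteq> A"
      using S(3) eq by (auto simp: A_def dest: inj_onD)
    then show "\<exists>T. openin Y T \<and> y \<in> T \<and> T \<subseteq> A"
      using pre[OF S(1,1)] S(2) y by (intro exI[of _ "{y \<in> topspace Y. f y \<in> S \<and> g y \<in> S}"]) auto
  qed
  moreover have "openin Y (topspace Y - A)"
  proof (subst openin_subopen, intro ballI)
    fix y assume "y \<in> topspace Y - A"
    then have y: "y \<in> topspace Y" "f y \<noteq> g y" by (auto simp: A_def)
    obtain S T where S: "openin Z S" "openin Z T" "f y \<in> S" "g y \<in> T" "S \<inter> T = {}"
      using *[OF y(1)] y(2) by auto
    have "{y \<in> topspace Y. f y \<in> S \<and> g y \<in> T} \<subseteq> topspace Y - A"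
      using S(5) by (auto simp: A_def)
    then show "\<exists>T. openin Y T \<and> y \<in> T \<and> T \<subseteq> topspace Y - A"
      using pre[OF S(1,2)] S(3,4) y by (intro exI[of _ "{y \<in> topspace Y. f y \<in> S \<and> g y \<in> T}"]) auto
  qed
  ultimately have "A = topspace Y"
    using connected_spaceD[OF Y, of A "topspace Y - A"] y0 by (auto simp: A_def)
  then show ?thesis using y by (auto simp: A_def)
qed

section \<open>Deck groups and orbit spaces\<close>

lemma deck_group_iff:
  "d \<in> carrier (deck_group Y p) \<longleftrightarrow>
     d \<in> extensional (topspace Y) \<and> homeomorphic_map Y Y d \<and> (\<forall>y\<in>topspace Y. p (d y) = p y)"
  by (simp add: deck_group_def)

lemma deckD:
  assumes "d \<in> carrier (deck_group Y p)"
  shows "homeomorphic_map Y Y d" "continuous_map Y Y d" "open_map Y Y d"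
    and "y \<in> topspace Y \<Longrightarrow> d y \<in> topspace Y" "y \<in> topspace Y \<Longrightarrow> p (d y) = p y"
proof -
  show h: "homeomorphic_map Y Y d" and "y \<in> topspace Y \<Longrightarrow> p (d y) = p y"
    using assms by (auto simp: deck_group_iff)
  show "continuous_map Y Y d" "open_map Y Y d" "y \<in> topspace Y \<Longrightarrow> d y \<in> topspace Y"
    using h homeomorphic_imp_surjective_map[OF h] by (auto simp: homeomorphic_eq_everything_map)
qed

lemma deck_mult_apply:
  assumes "d \<in> carrier (deck_group Y p)" "e \<in> carrier (deck_group Y p)" "y \<in> topspace Y"
  shows "(d \<otimes>\<^bsub>deck_group Y p\<^esub> e) y = d (e y)"
proof -
  have "d \<in> Bij (topspace Y)" "e \<in> Bij (topspace Y)"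
    using assms subgroup.subset[OF subgroup_deck_group] by (auto simp: BijGroup_def)
  then show ?thesis using assms(3) by (simp add: deck_group_def BijGroup_def compose_def)
qed

lemma deck_one_apply: "y \<in> topspace Y \<Longrightarrow> \<one>\<^bsub>deck_group Y p\<^esub> y = y"
  by (simp add: deck_group_def BijGroup_def)

lemma deck_inv_apply:
  assumes "d \<in> carrier (deck_group Y p)" "y \<in> topspace Y"
  shows "(inv\<^bsub>deck_group Y p\<^esub> d) (d y) = y" "d ((inv\<^bsub>deck_group Y p\<^esub> d) y) = y"
proof -
  interpret group "deck_group Y p" by (rule group_deck_group)
  show "(inv\<^bsub>deck_group Y p\<^esub> d) (d y) = y" "d ((inv\<^bsub>deck_group Y p\<^esub> d) y) = y"
    using assms deck_mult_apply[of _ Y p _ y] deck_one_apply[of y Y p] inv_closed l_inv r_inv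
    by metis+
qed

lemma deck_eqI:
  assumes "d \<in> carrier (deck_group Y p)" "e \<in> carrier (deck_group Y p')"
    and "\<And>y. y \<in> topspace Y \<Longrightarrow> d y = e y"
  shows "d = e"
  using assms extensionalityI[of d "topspace Y" e] by (auto simp: deck_group_iff)

text \<open>Deck transformations are lifts of \<open>p\<close> along \<open>p\<close> itself, so
  uniqueness of lifts makes the action of the deck group free.\<close>

lemma deck_eq_if_agree:
  assumes "covering_map Y X p" "connected_space Y"
    and d: "d \<in> carrier (deck_group Y p)" and e: "e \<in> carrier (deck_group Y p)"
    and "y \<in> topspace Y" "d y = e y"
  shows "d = e"
proof (rule deck_eqI[OF d e])
  fix y' assume "y' \<in> topspace Y"
  then show "d y' = e y'"
    using lifts_eq[OF assms(1,2) deckD(2)[OF d] deckD(2)[OF e] _ assms(5,6)] deckD(5)[OF d] deckD(5)[OF e]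
    by simp
qed

text \<open>Both groups are subgroups of the same group of bijections of \<open>topspace Y\<close>,
  so it is enough to prove the inclusion of carriers.\<close>

lemma subgroup_deck_group_factor:
  assumes "\<And>y. y \<in> topspace Y \<Longrightarrow> q (f y) = p y"
  shows "subgroup (carrier (deck_group Y f)) (deck_group Y p)"
proof -
  have "carrier (deck_group Y f) \<subseteq> carrier (deck_group Y p)"
  proof
    fix d assume d: "d \<in> carrier (deck_group Y f)"
    have "p (d y) = p y" if "y \<in> topspace Y" for y
      using assms[OF that] assms[OF deckD(4)[OF d that]] deckD(5)[OF d that] by simp
    then show "d \<in> carrier (deck_group Y p)" using d by (simp add: deck_group_iff)
  qed
  then have "subgroup (carrier (deck_group Y f))
      (BijGroup (topspace Y)\<lparr>carrier := carrier (deck_group Y p)\<rparr>)"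
    by (rule group.subgroup_incl[OF group_BijGroup subgroup_deck_group subgroup_deck_group])
  then show ?thesis by (simp add: deck_group_def)
qed

section \<open>Orbits and orbit spaces of subgroups of the deck group\<close>

lemma orbit_map_eq: "orbit_map Y H y = (\<lambda>h. h y) ` H"
  by (auto simp: orbit_map_def orbit_def)

lemma orbit_map_eq_iff:
  assumes H: "subgroup H (deck_group Y p)" and y: "y \<in> topspace Y" and y': "y' \<in> topspace Y"
  shows "orbit_map Y H y = orbit_map Y H y' \<longleftrightarrow> (\<exists>h\<in>H. y' = h y)"
proof -
  interpret group "deck_group Y p" by (rule group_deck_group)
  have HG: "h \<in> carrier (deck_group Y p)" if "h \<in> H" for h
    using subgroup.mem_carrier[OF H that] .
  have self: "y \<in> orbit_map Y H y" if "y \<in> topspace Y" for y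
    using deck_one_apply[OF that, of p] subgroup.one_closed[OF H]
    unfolding orbit_map_eq by (metis imageI)
  have sub: "orbit_map Y H (h y) \<subseteq> orbit_map Y H y" if "h \<in> H" "y \<in> topspace Y" for h y
  proof
    fix w assume "w \<in> orbit_map Y H (h y)"
    then obtain k where k: "k \<in> H" "w = k (h y)" by (auto simp: orbit_map_eq)
    then have "w = (k \<otimes>\<^bsub>deck_group Y p\<^esub> h) y" using deck_mult_apply HG that by metis
    then show "w \<in> orbit_map Y H y"
      using subgroup.m_closed[OF H k(1) that(1)] by (auto simp: orbit_map_eq)
  qed
  show ?thesis
  proof
    assume eq: "orbit_map Y H y = orbit_map Y H y'"
    then show "\<exists>h\<in>H. y' = h y" using self[OF y'] by (auto simp: orbit_map_eq)
  next
    assume "\<exists>h\<in>H. y' = h y"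
    then obtain h where h: "h \<in> H" "y' = h y" by auto
    have "orbit_map Y H y' \<subseteq> orbit_map Y H y" using sub[OF h(1) y] h(2) by simp
    moreover have "orbit_map Y H y \<subseteq> orbit_map Y H y'"
      using sub[OF subgroup.m_inv_closed[OF H h(1)] deckD(4)[OF HG[OF h(1)] y]] h(2)
        deck_inv_apply(1)[OF HG[OF h(1)] y] by simp
    ultimately show "orbit_map Y H y = orbit_map Y H y'" by blast
  qed
qed

lemma induced_map_orbit:
  assumes H: "subgroup H (deck_group Y p)" and y: "y \<in> topspace Y"
  shows "induced_map p (orbit_map Y H y) = p y"
proof -
  have "p (h y) = p y" if "h \<in> H" for h
    using deckD(5)[OF subgroup.mem_carrier[OF H that] y] .
  then have "p ` orbit_map Y H y = {p y}"
    using subgroup.one_closed[OF H] by (auto simp: orbit_map_eq image_image)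
  then show ?thesis by (simp add: induced_map_def)
qed

lemma quotient_map_orbit_map: "quotient_map Y (orbit_space Y H) (orbit_map Y H)"
  unfolding orbit_space_def by (rule quotient_map_quotient_topology)

lemma topspace_orbit_space: "topspace (orbit_space Y H) = orbit_map Y H ` topspace Y"
  by (simp add: orbit_space_def topspace_quotient_topology)

lemma continuous_map_induced_map:
  assumes "continuous_map Y X p" "subgroup H (deck_group Y p)"
  shows "continuous_map (orbit_space Y H) X (induced_map p)"
proof (rule continuous_compose_quotient_map[OF quotient_map_orbit_map])
  show "continuous_map Y X (induced_map p \<circ> orbit_map Y H)"
    by (rule continuous_map_eq[OF assms(1)]) (simp add: induced_map_orbit[OF assms(2)])
qed

text \<open>Since \<open>p\<close> factors through the quotient map onto orbits, the induced map is
  always a quotient map. It is a homeomorphism exactly when it is injective, which means that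
  \<open>H\<close> is transitive on the fibres of \<open>p\<close>.\<close>

lemma homeomorphic_map_induced_map_iff:
  assumes p: "quotient_map Y X p" and H: "subgroup H (deck_group Y p)"
  shows "homeomorphic_map (orbit_space Y H) X (induced_map p) \<longleftrightarrow>
    (\<forall>y\<in>topspace Y. \<forall>y'\<in>topspace Y. p y = p y' \<longrightarrow> (\<exists>h\<in>H. y' = h y))"
proof -
  have "quotient_map Y X (induced_map p \<circ> orbit_map Y H)"
    by (rule quotient_map_eq[OF p]) (simp add: induced_map_orbit[OF H])
  then have "quotient_map (orbit_space Y H) X (induced_map p)"
    using quotient_map_compose_eq[OF quotient_map_orbit_map] by blast
  then have "homeomorphic_map (orbit_space Y H) X (induced_map p) \<longleftrightarrow>
      inj_on (induced_map p) (topspace (orbit_space Y H))"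
    by (simp add: homeomorphic_map_def)
  also have "\<dots> \<longleftrightarrow> (\<forall>y\<in>topspace Y. \<forall>y'\<in>topspace Y. p y = p y' \<longrightarrow>
      orbit_map Y H y = orbit_map Y H y')"
    by (simp add: inj_on_def topspace_orbit_space induced_map_orbit[OF H])
  also have "\<dots> \<longleftrightarrow> (\<forall>y\<in>topspace Y. \<forall>y'\<in>topspace Y. p y = p y' \<longrightarrow> (\<exists>h\<in>H. y' = h y))"
    using orbit_map_eq_iff[OF H] by blast
  finally show ?thesis .
qed

section \<open>Galois covers as transitive covers\<close>

lemma surjective_covering_quotient_map:
  assumes "covering_map Y X p" "p ` topspace Y = topspace X"
  shows "quotient_map Y X p"
  using continuous_open_imp_quotient_map[OF covering_map_continuous_map covering_map_open_map] assms
  by blast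

text \<open>Surjectivity appears as a separate condition because fibres of a cover may be empty; in
  the definition it is hidden in the homeomorphism onto \<open>X\<close>.\<close>

lemma galois_cover_iff:
  "galois_cover Y X p \<longleftrightarrow>
     covering_map Y X p \<and> connected_space Y \<and> p ` topspace Y = topspace X \<and>
     (\<forall>y\<in>topspace Y. \<forall>y'\<in>topspace Y. p y = p y' \<longrightarrow> (\<exists>d\<in>carrier (deck_group Y p). y' = d y))"
proof -
  let ?G = "carrier (deck_group Y p)"
  have G: "subgroup ?G (deck_group Y p)"
    by (rule group.subgroup_self[OF group_deck_group])
  have "p ` topspace Y = topspace X"
    if "homeomorphic_map (orbit_space Y ?G) X (induced_map p)"
    using homeomorphic_imp_surjective_map[OF that] induced_map_orbit[OF G]
    by (simp add: topspace_orbit_space image_image)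
  then show ?thesis
    unfolding galois_cover_def
    using homeomorphic_map_induced_map_iff[OF surjective_covering_quotient_map G] by blast
qed

text \<open>Intermediate covers are required to be admissible; applied to the orbit map, this lemma
  supplies that for orbit spaces. Local path-connectedness passes to quotients, so the work is in
  the second condition.\<close>

lemma admissible_covering_image:
  assumes f: "covering_map Y Z f" and surj: "f ` topspace Y = topspace Z" and Y: "admissible_space Y"
  shows "admissible_space Z"
  unfolding admissible_space_def
proof
  show "locally_path_connected_space Z"
    using locally_path_connected_space_quotient_map_image[OF surjective_covering_quotient_map[OF f surj]] Y
    by (simp add: admissible_space_def)
  have cf: "continuous_map Y Z f" and "open_map Y Z f"
    using covering_map_continuous_map[OF f] covering_map_open_map[OF f] .
  txt \<open>No homotopy lifting is needed: a small loop lifts through one sheet, is null-homotopic in \<open>Y\<close>,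
    and the homotopy is pushed forward along \<open>f\<close>.\<close>
  show "semilocally_simply_connected_space Z"
    unfolding semilocally_simply_connected_space_def
  proof
    fix z assume "z \<in> topspace Z"
    then obtain y where y: "y \<in> topspace Y" "f y = z" using surj by force
    obtain U where U: "openin Y U" "y \<in> U"
      and null: "\<And>g. \<lbrakk>pathin (subtopology Y U) g; g 0 = y; g 1 = y\<rbrakk> \<Longrightarrow>
        homotopic_with (\<lambda>h. h 0 = y \<and> h 1 = y) (top_of_set {0..1}) Y g (\<lambda>t. y)"
      using Y y(1) unfolding admissible_space_def semilocally_simply_connected_space_def by meson
    obtain W V where "sheets Y Z f z W V" using covering_map_sheets[OF f \<open>z \<in> topspace Z\<close>] .
    note S = sheetsD[OF this]
    \<comment> \<open>Inside \<open>U\<close> loops at \<open>y\<close> contract in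
      \<open>Y\<close>; inside one sheet \<open>f\<close> is injective. On the intersection both
      hold, and \<open>f\<close> has a continuous local inverse \<open>s\<close>.\<close>
    define T where "T = U \<inter> V y"
    have T: "openin Y T" "y \<in> T" "T \<subseteq> U" "inj_on f T"
      using U S(5,6,7) y by (auto simp: T_def intro: inj_on_subset)
    have fT: "openin Z (f ` T)" "z \<in> f ` T"
      using \<open>open_map Y Z f\<close> T y by (auto simp: open_map_def)
    have "homeomorphic_map (subtopology Y T) (subtopology Z (f ` T)) f"
      using homeomorphic_map_open_restriction[OF cf \<open>open_map Y Z f\<close> T(1) fT(1) T(4)] by simp
    then obtain s where "homeomorphic_maps (subtopology Y T) (subtopology Z (f ` T)) f s"
      using homeomorphic_map_maps by blast
    then have s: "continuous_map (subtopology Z (f ` T)) (subtopology Y T) s"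
        "\<And>v. v \<in> T \<Longrightarrow> s (f v) = v" "\<And>w. w \<in> f ` T \<Longrightarrow> f (s w) = w"
      using openin_subset[OF T(1)] openin_subset[OF fT(1)]
      by (auto simp: homeomorphic_maps_def)
    have "homotopic_with (\<lambda>h. h 0 = z \<and> h 1 = z) (top_of_set {0..1}) Z g (\<lambda>t. z)"
      if g: "pathin (subtopology Z (f ` T)) g" "g 0 = z" "g 1 = z" for g
    proof -
      have "pathin (subtopology Y T) (s \<circ> g)"
        using continuous_map_compose[OF g(1)[unfolded pathin_def] s(1)] by (simp add: pathin_def)
      then have "pathin (subtopology Y U) (s \<circ> g)"
        using T(3) by (auto simp: pathin_subtopology)
      moreover have "s z = y" using s(2) T y by blast
      ultimately have "homotopic_with (\<lambda>h. h 0 = y \<and> h 1 = y) (top_of_set {0..1}) Y (s \<circ> g) (\<lambda>t. y)"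
        using null g by simp
      then have hom: "homotopic_with (\<lambda>h. h 0 = z \<and> h 1 = z) (top_of_set {0..1}) Z
          (f \<circ> (s \<circ> g)) (f \<circ> (\<lambda>t. y))"
        by (rule homotopic_with_compose_continuous_map_left[OF _ cf]) (simp add: y)
      have "g t \<in> f ` T" if "t \<in> {0..1}" for t
        using g(1) that unfolding pathin_def continuous_map_def by auto
      then show ?thesis
        by (intro homotopic_with_eq[OF hom]) (auto simp: s(3) y)
    qed
    then show "\<exists>U. openin Z U \<and> z \<in> U \<and>
        (\<forall>g. pathin (subtopology Z U) g \<and> g 0 = z \<and> g 1 = z \<longrightarrow>
             homotopic_with (\<lambda>h. h 0 = z \<and> h 1 = z) (top_of_set {0..1}) Z g (\<lambda>t. z))"
      using fT by blast
  qed
qed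

text \<open>The union of the orbits through \<open>T\<close> is the union of its translates under
  \<open>H\<close>, each open because every \<open>h\<close> is a homeomorphism.\<close>

lemma open_map_orbit_map:
  assumes H: "subgroup H (deck_group Y p)"
  shows "open_map Y (orbit_space Y H) (orbit_map Y H)"
  unfolding open_map_def
proof (intro allI impI)
  fix T assume T: "openin Y T"
  have sub: "T \<subseteq> topspace Y" using openin_subset[OF T] .
  have "{y \<in> topspace Y. orbit_map Y H y \<in> orbit_map Y H ` T} = (\<Union>h\<in>H. h ` T)"
  proof -
    have "orbit_map Y H y \<in> orbit_map Y H ` T \<longleftrightarrow> y \<in> (\<Union>h\<in>H. h ` T)" if "y \<in> topspace Y" for y
    proof -
      have "orbit_map Y H t = orbit_map Y H y \<longleftrightarrow> (\<exists>h\<in>H. y = h t)" if "t \<in> T" for t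
        using orbit_map_eq_iff[OF H] that sub \<open>y \<in> topspace Y\<close> by blast
      then show ?thesis by (auto simp: image_iff) metis+
    qed
    moreover have "(\<Union>h\<in>H. h ` T) \<subseteq> topspace Y"
      using deckD(4)[OF subgroup.mem_carrier[OF H]] sub by blast
    ultimately show ?thesis by blast
  qed
  moreover have "openin Y (\<Union>h\<in>H. h ` T)"
    using deckD(3)[OF subgroup.mem_carrier[OF H]] T by (auto simp: open_map_def)
  ultimately show "openin (orbit_space Y H) (orbit_map Y H ` T)"
    using sub by (auto simp: orbit_space_def openin_quotient_topology)
qed

text \<open>Each \<open>h\<close> in \<open>H\<close> is a lift of \<open>p\<close> along
  \<open>p\<close>, so \<open>lift_sheet_image\<close> shows that it carries sheets over a connected
  \<open>U\<close> to sheets. Sheets of the orbit space are therefore images of sheets of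
  \<open>p\<close>.\<close>

lemma covering_map_induced_map:
  assumes X: "locally_path_connected_space X" and p: "covering_map Y X p"
    and H: "subgroup H (deck_group Y p)"
  shows "covering_map (orbit_space Y H) X (induced_map p)"
  unfolding covering_map_iff_sheets
proof (intro conjI ballI)
  let ?r = "orbit_map Y H" and ?Q = "orbit_space Y H" and ?p = "induced_map p"
  note top = topspace_orbit_space[of Y H]
  note pr = induced_map_orbit[OF H]
  have rr: "?r y = ?r y' \<longleftrightarrow> (\<exists>h\<in>H. y' = h y)" if "y \<in> topspace Y" "y' \<in> topspace Y" for y y'
    using orbit_map_eq_iff[OF H that] .
  show cont: "continuous_map ?Q X ?p"
    using continuous_map_induced_map[OF covering_map_continuous_map[OF p] H] .
  show "open_map ?Q X ?p"
    unfolding open_map_def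
  proof (intro allI impI)
    fix T assume T: "openin ?Q T"
    then have "openin Y {y \<in> topspace Y. ?r y \<in> T}" and sub: "T \<subseteq> ?r ` topspace Y"
      by (auto simp: orbit_space_def openin_quotient_topology)
    then have "openin X (p ` {y \<in> topspace Y. ?r y \<in> T})"
      using covering_map_open_map[OF p] by (simp add: open_map_def)
    moreover have "p ` {y \<in> topspace Y. ?r y \<in> T} = ?p ` T"
      using sub pr by (force simp: image_iff)
    ultimately show "openin X (?p ` T)" by simp
  qed
  fix x assume "x \<in> topspace X"
  then obtain U V where V: "sheets Y X p x U V" and U: "connectedin X U"
    using connected_sheets[OF X p openin_topspace] by blast
  note S = sheetsD[OF V]
  \<comment> \<open>The union over all representatives avoids choosing one; for orbits over
    \<open>x\<close> all its terms coincide, as shown next.\<close>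
  define W where "W z = (\<Union>y\<in>{y \<in> topspace Y. ?r y = z}. ?r ` V y)" for z
  have W: "W (?r y) = ?r ` V y" if y: "y \<in> topspace Y" "p y = x" for y
  proof -
    have "?r ` V y' = ?r ` V y" if y': "y' \<in> topspace Y" "?r y' = ?r y" for y'
    proof -
      obtain h where h: "h \<in> H" "y' = h y" using rr[OF y(1) y'(1)] y'(2) by auto
      note hG = subgroup.mem_carrier[OF H h(1)]
      have "h ` V y = V y'"
        using lift_sheet_image[OF p p V V U deckD(2)[OF hG] deckD(5)[OF hG] y] h(2) by simp
      moreover have "?r (h v) = ?r v" if "v \<in> V y" for v
        using rr[of v "h v"] h(1) S(9)[OF y that] deckD(4)[OF hG] by metis
      ultimately show ?thesis by (metis (no_types, lifting) image_cong image_image)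
    qed
    then have "W (?r y) = (\<Union>y'\<in>{y' \<in> topspace Y. ?r y' = ?r y}. ?r ` V y)"
      unfolding W_def by (intro SUP_cong) auto
    then show ?thesis using y(1) by auto
  qed
  have fibre: "\<exists>y\<in>topspace Y. z = ?r y \<and> p y = x" if "z \<in> topspace ?Q" "?p z = x" for z
    using that top pr by auto
  have "sheets ?Q X ?p x U W"
    unfolding sheets_def
  proof (intro conjI ballI impI)
    show "openin X U" "x \<in> U" using S(1,2) by auto
  next
    fix v assume "v \<in> topspace ?Q" "?p v \<in> U"
    then obtain u where u: "u \<in> topspace Y" "v = ?r u" "p u \<in> U" using top pr by auto
    then obtain y where y: "y \<in> topspace Y" "p y = x" "u \<in> V y" using S(3) by blast
    then show "\<exists>z\<in>topspace ?Q. ?p z = x \<and> v \<in> W z"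
      using u top pr W by (intro bexI[of _ "?r y"]) auto
  next
    fix z z' assume z: "z \<in> topspace ?Q" "z' \<in> topspace ?Q" "?p z = x" "?p z' = x" "W z \<inter> W z' \<noteq> {}"
    obtain y where y: "y \<in> topspace Y" "z = ?r y" "p y = x" using fibre z by blast
    obtain y' where y': "y' \<in> topspace Y" "z' = ?r y'" "p y' = x" using fibre z by blast
    obtain v v' where v: "v \<in> V y" "v' \<in> V y'" "?r v = ?r v'"
      using z(5) W y y' by auto
    \<comment> \<open>If two quotient sheets meet, some \<open>h\<close> moves a point of
      \<open>V y\<close> into \<open>V y'\<close>. It then carries the whole sheet, and with it the
      centre \<open>y\<close> to \<open>y'\<close>, so the two orbits are equal.\<close>
    obtain h where h: "h \<in> H" "v' = h v" using v rr S(9) y y' by metis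
    note hG = subgroup.mem_carrier[OF H h(1)]
    have "h ` V y = V (h y)"
      using lift_sheet_image[OF p p V V U deckD(2)[OF hG] deckD(5)[OF hG] y(1,3)] by simp
    then have "v' \<in> V (h y)" using h v by auto
    then have "y' = h y" using S(4)[of y' "h y"] v(2) y' y deckD(4,5)[OF hG y(1)] by auto
    then show "z = z'" using rr y y' h by blast
  next
    fix z assume z: "z \<in> topspace ?Q" "?p z = x"
    then obtain y where y: "y \<in> topspace Y" "z = ?r y" "p y = x" using fibre by blast
    note y' = y(1,3)
    have Wz: "W z = ?r ` V y" using W y by simp
    have pV: "?p (?r v) = p v" if "v \<in> V y" for v using pr S(9)[OF y' that] by simp
    show "openin ?Q (W z)"
      using open_map_orbit_map[OF H] S(5)[OF y'] Wz by (simp add: open_map_def)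
    show "z \<in> W z" using Wz y(2) S(6)[OF y'] by simp
    show "inj_on ?p (W z)"
      using Wz pV S(7)[OF y'] by (auto simp: inj_on_def)
    show "?p ` W z = U"
      using Wz pV S(8)[OF y'] by (simp add: image_image)
  qed
  then show "\<exists>U V. sheets ?Q X ?p x U V" by blast
qed

section \<open>Intermediate covers\<close>

lemma intermediate_coversD:
  assumes "(Z, q, f) \<in> intermediate_covers Y X p"
  shows "admissible_space Z" "connected_space Z" "covering_map Z X q" "continuous_map Y Z f"
    and "y \<in> topspace Y \<Longrightarrow> q (f y) = p y" "y \<in> topspace Y \<Longrightarrow> f y \<in> topspace Z"
  using assms by (auto simp: intermediate_covers_def continuous_map_def)

lemma galois_coverD:
  assumes "galois_cover Y X p"
  shows "covering_map Y X p" "connected_space Y" "p ` topspace Y = topspace X"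
    and "\<lbrakk>y \<in> topspace Y; y' \<in> topspace Y; p y = p y'\<rbrakk> \<Longrightarrow> \<exists>d\<in>carrier (deck_group Y p). y' = d y"
  using assms galois_cover_iff by metis+

lemma galois_cover_intermediate:
  assumes X: "locally_path_connected_space X" and p: "galois_cover Y X p"
    and c: "(Z, q, f) \<in> intermediate_covers Y X p"
  shows "galois_cover Y Z f"
  unfolding galois_cover_iff
proof (intro conjI ballI impI)
  note P = galois_coverD[OF p] and C = intermediate_coversD[OF c]
  show "covering_map Y Z f" using lift_covering_map[OF X P(1) C(3,4,5)] .
  show "connected_space Y" by (rule P(2))
  show "f ` topspace Y = topspace Z"
  \<comment> \<open>\<open>lift_surjective\<close> needs a point of \<open>Y\<close>. If there is
    none, surjectivity of \<open>p\<close> makes \<open>X\<close> empty, and \<open>Z\<close>, which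
    maps to \<open>X\<close>, is empty as well.\<close>
  proof (cases "topspace Y = {}")
    case True
    then have "topspace X = {}" using P(3) by simp
    then show ?thesis
      using True covering_map_continuous_map[OF C(3)] by (auto simp: continuous_map_def)
  next
    case False
    then show ?thesis using lift_surjective[OF X P(1) C(3,4,5,2)] by simp
  qed
  fix y y' assume y: "y \<in> topspace Y" "y' \<in> topspace Y" "f y = f y'"
  then have "p y = p y'" using C(5) by metis
  then obtain d where d: "d \<in> carrier (deck_group Y p)" "y' = d y" using P(4) y by blast
  \<comment> \<open>\<open>f \<circ> d\<close> and \<open>f\<close> are both lifts of
    \<open>p\<close> along \<open>q\<close>, and they agree at \<open>y\<close>.\<close>
  have "f (d v) = f v" if "v \<in> topspace Y" for v
  proof (rule lifts_eq[OF C(3) P(2) _ C(4) _ y(1) _ that])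
    show "continuous_map Y Z (\<lambda>v. f (d v))"
      using continuous_map_compose[OF deckD(2)[OF d(1)] C(4)] by (simp add: comp_def)
    show "q (f (d u)) = q (f u)" if "u \<in> topspace Y" for u
      using C(5) that deckD(4,5)[OF d(1) that] by simp
    show "f (d y) = f y" using y(3) d(2) by simp
  qed
  then have "d \<in> carrier (deck_group Y f)" using d(1) by (simp add: deck_group_iff)
  then show "\<exists>d\<in>carrier (deck_group Y f). y' = d y" using d(2) by blast
qed

text \<open>The isomorphism is \<open>induced_map f\<close>, a homeomorphism because
  \<open>f\<close> is Galois. Its compatibility with the maps from \<open>Y\<close> and to
  \<open>X\<close> can be checked on representatives of orbits.\<close>

lemma iso_quotient_cover_deck_group:
  assumes X: "locally_path_connected_space X" and p: "galois_cover Y X p"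
    and c: "(Z, q, f) \<in> intermediate_covers Y X p"
  shows "iso_intermediate Y (quotient_cover Y p (carrier (deck_group Y f))) (Z, q, f)"
proof -
  let ?H = "carrier (deck_group Y f)"
  note C = intermediate_coversD[OF c]
  have H: "subgroup ?H (deck_group Y p)" using subgroup_deck_group_factor[of Y q f p] C(5) by blast
  have Hf: "subgroup ?H (deck_group Y f)" by (rule group.subgroup_self[OF group_deck_group])
  have "homeomorphic_map (orbit_space Y ?H) Z (induced_map f)"
    using galois_cover_intermediate[OF X p c] by (simp add: galois_cover_def)
  then show ?thesis
    unfolding iso_intermediate_def quotient_cover_def
    by (auto simp: induced_map_orbit[OF Hf] induced_map_orbit[OF H] topspace_orbit_space C(5))
qed

text \<open>The orbit map is a lift of \<open>p\<close> along the cover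
  \<open>induced_map p\<close>, hence a cover itself, and it passes admissibility from
  \<open>Y\<close> to the orbit space. Connectedness passes along any quotient map.\<close>

lemma quotient_cover_intermediate:
  assumes X: "locally_path_connected_space X" and Y: "admissible_space Y" and p: "galois_cover Y X p"
    and H: "subgroup H (deck_group Y p)"
  shows "quotient_cover Y p H \<in> intermediate_covers Y X p"
proof -
  note P = galois_coverD[OF p]
  have cov: "covering_map (orbit_space Y H) X (induced_map p)"
    using covering_map_induced_map[OF X P(1) H] .
  have cont: "continuous_map Y (orbit_space Y H) (orbit_map Y H)"
    using quotient_imp_continuous_map[OF quotient_map_orbit_map] .
  have "covering_map Y (orbit_space Y H) (orbit_map Y H)"
    using lift_covering_map[OF X P(1) cov cont] induced_map_orbit[OF H] by simp
  then have "admissible_space (orbit_space Y H)"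
    using admissible_covering_image[OF _ _ Y] topspace_orbit_space by metis
  moreover have "connected_space (orbit_space Y H)"
    using connected_space_quotient_map_image[OF quotient_map_orbit_map P(2)] .
  ultimately show ?thesis
    using cov cont induced_map_orbit[OF H] by (simp add: intermediate_covers_def quotient_cover_def)
qed

text \<open>A deck transformation preserving \<open>H\<close>-orbits agrees at one point with some
  \<open>h\<close> in \<open>H\<close>, hence everywhere by freeness. For empty \<open>Y\<close>
  there is no such point, but then only the identity exists.\<close>

lemma Aut_over_quotient_cover:
  assumes p: "galois_cover Y X p" and H: "subgroup H (deck_group Y p)"
  shows "Aut_over Y (quotient_cover Y p H) = H"
proof -
  note P = galois_coverD[OF p]
  have "subgroup (carrier (deck_group Y (orbit_map Y H))) (deck_group Y p)"
    by (rule subgroup_deck_group_factor[of Y "induced_map p"]) (rule induced_map_orbit[OF H])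
  then have sub: "carrier (deck_group Y (orbit_map Y H)) \<subseteq> carrier (deck_group Y p)"
    by (rule subgroup.subset)
  have "carrier (deck_group Y (orbit_map Y H)) = H"
  proof
    show "H \<subseteq> carrier (deck_group Y (orbit_map Y H))"
    proof
      fix h assume h: "h \<in> H"
      note hG = subgroup.mem_carrier[OF H h]
      have "orbit_map Y H (h y) = orbit_map Y H y" if "y \<in> topspace Y" for y
        using orbit_map_eq_iff[OF H that deckD(4)[OF hG that]] h by blast
      then show "h \<in> carrier (deck_group Y (orbit_map Y H))" using hG by (simp add: deck_group_iff)
    qed
    show "carrier (deck_group Y (orbit_map Y H)) \<subseteq> H"
    proof
      fix d assume d: "d \<in> carrier (deck_group Y (orbit_map Y H))"
      then have dG: "d \<in> carrier (deck_group Y p)" using sub by blast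
      show "d \<in> H"
      proof (cases "topspace Y = {}")
        case True
        then have "d = \<one>\<^bsub>deck_group Y p\<^esub>"
          using deck_eqI[OF dG monoid.one_closed[OF group.is_monoid[OF group_deck_group]]] by blast
        then show ?thesis using subgroup.one_closed[OF H] by simp
      next
        case False
        then obtain y where y: "y \<in> topspace Y" by blast
        then obtain h where h: "h \<in> H" "d y = h y"
          using orbit_map_eq_iff[OF H y deckD(4)[OF d y]] deckD(5)[OF d y] by metis
        have "d = h"
          using deck_eq_if_agree[OF P(1,2) dG subgroup.mem_carrier[OF H h(1)] y h(2)] .
        then show ?thesis using h by simp
      qed
    qed
  qed
  then show ?thesis by (simp add: Aut_over_def quotient_cover_def)
qed

section \<open>Isomorphism classes and their automorphism groups\<close>

lemma iso_intermediate_commute: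
  assumes "c \<in> intermediate_covers Y X p" "iso_intermediate Y c c'"
  shows "iso_intermediate Y c' c"
proof -
  obtain Z q f Z' q' f' where t: "c = (Z, q, f)" "c' = (Z', q', f')" by (metis prod_cases3)
  show ?thesis
    using iso_intermediate_sym assms(2) intermediate_coversD(6)[OF assms(1)[unfolded t]]
    unfolding t by blast
qed

text \<open>The automorphisms over \<open>Z\<close> depend only on the partition of \<open>Y\<close>
  into fibres of \<open>f\<close>, and an injective \<open>\<phi>\<close> preserves this
  partition.\<close>

lemma Aut_over_eq_if_iso:
  assumes c: "c \<in> intermediate_covers Y X p" and iso: "iso_intermediate Y c c'"
  shows "Aut_over Y c = Aut_over Y c'"
proof -
  obtain Z q f Z' q' f' where t: "c = (Z, q, f)" "c' = (Z', q', f')" by (metis prod_cases3)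
  obtain \<phi> where \<phi>: "homeomorphic_map Z Z' \<phi>" "\<forall>y\<in>topspace Y. \<phi> (f y) = f' y"
    using iso unfolding t iso_intermediate_def by auto
  note C = intermediate_coversD[OF c[unfolded t]]
  have "f' a = f' b \<longleftrightarrow> f a = f b" if "a \<in> topspace Y" "b \<in> topspace Y" for a b
    using \<phi>(2) that C(6) homeomorphic_imp_injective_map[OF \<phi>(1)] by (metis inj_onD)
  moreover have "d y \<in> topspace Y" if "homeomorphic_map Y Y d" "y \<in> topspace Y" for d y
    using homeomorphic_imp_surjective_map[OF that(1)] that(2) by blast
  ultimately have "d \<in> carrier (deck_group Y f) \<longleftrightarrow> d \<in> carrier (deck_group Y f')" for d
    by (auto simp: deck_group_iff)
  then show ?thesis by (auto simp: t Aut_over_def)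
qed

lemma subgroup_Aut_over:
  assumes "c \<in> intermediate_covers Y X p"
  shows "subgroup (Aut_over Y c) (deck_group Y p)"
proof -
  obtain Z q f where t: "c = (Z, q, f)" by (metis prod_cases3)
  show ?thesis
    using subgroup_deck_group_factor[of Y q f p] intermediate_coversD(5)[OF assms[unfolded t]]
    by (simp add: t Aut_over_def)
qed

lemma iso_quotient_cover_Aut_over:
  assumes "locally_path_connected_space X" "galois_cover Y X p" "c \<in> intermediate_covers Y X p"
  shows "iso_intermediate Y (quotient_cover Y p (Aut_over Y c)) c"
proof -
  obtain Z q f where t: "c = (Z, q, f)" by (metis prod_cases3)
  show ?thesis
    using iso_quotient_cover_deck_group[OF assms(1,2) assms(3)[unfolded t]] by (simp add: t Aut_over_def)
qed

text \<open>Equal groups give the same quotient cover, to which both covers are isomorphic. The two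
  covers may have points of different types.\<close>

lemma iso_intermediate_iff_Aut_over_eq:
  assumes "locally_path_connected_space X" "admissible_space Y" "galois_cover Y X p"
    and c: "c \<in> intermediate_covers Y X p" and c': "c' \<in> intermediate_covers Y X p"
  shows "iso_intermediate Y c c' \<longleftrightarrow> Aut_over Y c = Aut_over Y c'"
proof
  assume "Aut_over Y c = Aut_over Y c'"
  then have "iso_intermediate Y (quotient_cover Y p (Aut_over Y c)) c'"
    using iso_quotient_cover_Aut_over[OF assms(1,3) c'] by simp
  moreover have "iso_intermediate Y c (quotient_cover Y p (Aut_over Y c))"
    using iso_intermediate_commute[OF quotient_cover_intermediate[OF assms(1-3) subgroup_Aut_over[OF c]]]
      iso_quotient_cover_Aut_over[OF assms(1,3) c] .
  ultimately show "iso_intermediate Y c c'" by (metis iso_intermediate_trans)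
qed (rule Aut_over_eq_if_iso[OF c])

text \<open>\<open>Aut_over\<close> is constant on a class, so its image is a singleton;
  \<open>the_elem\<close> turns it into a map on classes.\<close>

lemma the_elem_Aut_over_class:
  assumes "c \<in> intermediate_covers Y X p"
  shows "the_elem (Aut_over Y ` (iso_rel Y X p `` {c})) = Aut_over Y c"
proof -
  have "c \<in> iso_rel Y X p `` {c}"
    using assms iso_intermediate_refl[of Y c] by (simp add: iso_rel_def)
  moreover have "Aut_over Y c' = Aut_over Y c" if "c' \<in> iso_rel Y X p `` {c}" for c'
    using that Aut_over_eq_if_iso[OF assms, of c'] by (simp add: iso_rel_def)
  ultimately have "Aut_over Y ` (iso_rel Y X p `` {c}) = {Aut_over Y c}" by blast
  then show ?thesis by simp
qed

lemma quotient_cover_Aut_over_class: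
  fixes Y :: "'y topology" and p :: "'y \<Rightarrow> 'x"
  assumes "locally_path_connected_space X" "admissible_space Y" "galois_cover Y X p"
    and c: "c \<in> intermediate_covers Y X p"
  shows "iso_rel Y X p `` {quotient_cover Y p (Aut_over Y c)} = iso_rel Y X p `` {c}"
proof -
  have "(quotient_cover Y p (Aut_over Y c), c) \<in> iso_rel Y X p"
    using quotient_cover_intermediate[OF assms(1-3) subgroup_Aut_over[OF c]] c
      iso_quotient_cover_Aut_over[OF assms(1,3) c] by (simp add: iso_rel_def)
  then show ?thesis by (rule equiv_class_eq[OF equiv_iso_rel])
qed

section \<open>Descending and lifting deck transformations\<close>

lemma deck_descends_if_normal:
  assumes X: "locally_path_connected_space X" and p: "galois_cover Y X p"
    and c: "(Z, q, f) \<in> intermediate_covers Y X p"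
    and N: "carrier (deck_group Y f) \<lhd> deck_group Y p" and g: "g \<in> carrier (deck_group Y p)"
  shows "\<exists>e\<in>carrier (deck_group Z q). \<forall>y\<in>topspace Y. e (f y) = f (g y)"
proof -
  interpret group "deck_group Y p" by (rule group_deck_group)
  note C = intermediate_coversD[OF c]
  note F = galois_coverD[OF galois_cover_intermediate[OF X p c]]
  have quot: "quotient_map Y Z f" using surjective_covering_quotient_map[OF F(1,3)] .
  \<comment> \<open>Stated for arbitrary \<open>k\<close> because it is applied to \<open>g\<close>
    and to its inverse; the two maps obtained on \<open>Z\<close> are inverse to each other.\<close>
  have descent: "\<exists>e. continuous_map Z Z e \<and> (\<forall>y\<in>topspace Y. e (f y) = f (k y))"
    if k: "k \<in> carrier (deck_group Y p)" for k
  proof -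
    have cont: "continuous_map Y Z (\<lambda>y. f (k y))"
      using continuous_map_compose[OF deckD(2)[OF k] C(4)] by (simp add: comp_def)
    show ?thesis
    proof (rule quotient_map_lift_exists[OF quot cont])
      fix y y' assume y: "y \<in> topspace Y" "y' \<in> topspace Y" "f y = f y'"
      obtain h where h: "h \<in> carrier (deck_group Y f)" "y' = h y" using F(4)[OF y] by blast
      have hG: "h \<in> carrier (deck_group Y p)"
        using subgroup.mem_carrier[OF normal_imp_subgroup[OF N] h(1)] .
      \<comment> \<open>With \<open>y' = h y\<close>, the point \<open>k y'\<close> is the image of
        \<open>k y\<close> under the conjugate of \<open>h\<close> by \<open>k\<close>. Normality
        makes this conjugate preserve \<open>f\<close>, so \<open>f \<circ> k\<close> is constant on
        fibres of \<open>f\<close>.\<close>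
      have conj: "k \<otimes>\<^bsub>deck_group Y p\<^esub> h \<otimes>\<^bsub>deck_group Y p\<^esub> inv\<^bsub>deck_group Y p\<^esub> k
          \<in> carrier (deck_group Y f)"
        using N k h(1) by (simp add: normal_inv_iff)
      have ky: "k y \<in> topspace Y" using deckD(4)[OF k y(1)] .
      have "f ((k \<otimes>\<^bsub>deck_group Y p\<^esub> h \<otimes>\<^bsub>deck_group Y p\<^esub> inv\<^bsub>deck_group Y p\<^esub> k) (k y)) = f (k y)"
        using deckD(5)[OF conj ky] .
      then show "f (k y) = f (k y')"
        using k hG ky h(2) y(1) by (simp add: deck_mult_apply deck_inv_apply)
    next
      fix e assume "continuous_map Z Z e" "\<And>y. y \<in> topspace Y \<Longrightarrow> e (f y) = f (k y)"
      then show ?thesis by blast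
    qed
  qed
  obtain e where e: "continuous_map Z Z e" "\<forall>y\<in>topspace Y. e (f y) = f (g y)"
    using descent[OF g] by (elim exE conjE)
  obtain e' where e': "continuous_map Z Z e'"
      "\<forall>y\<in>topspace Y. e' (f y) = f ((inv\<^bsub>deck_group Y p\<^esub> g) y)"
    using descent[OF inv_closed[OF g]] by (elim exE conjE)
  have "e' (e z) = z \<and> e (e' z) = z" if "z \<in> topspace Z" for z
  proof -
    have "z \<in> f ` topspace Y" using F(3) that by simp
    then obtain y where y: "y \<in> topspace Y" "z = f y" by (auto elim!: imageE)
    then show ?thesis
      using e(2) e'(2) deck_inv_apply[OF g y(1)] deckD(4)[OF g y(1)] deckD(4)[OF inv_closed[OF g] y(1)]
      by simp
  qed
  then have "homeomorphic_map Z Z e"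
    using e(1) e'(1) by (auto simp: homeomorphic_map_maps homeomorphic_maps_def)
  \<comment> \<open>Elements of \<open>deck_group\<close> are extensional, so \<open>e\<close> is
    cut off outside \<open>topspace Z\<close>.\<close>
  then have hom: "homeomorphic_map Z Z (restrict e (topspace Z))"
    by (rule homeomorphic_map_eq) simp
  have "q (e z) = q z" if "z \<in> topspace Z" for z
  proof -
    have "z \<in> f ` topspace Y" using F(3) that by simp
    then obtain y where y: "y \<in> topspace Y" "z = f y" by (auto elim!: imageE)
    then show ?thesis using e(2) C(5) deckD(4,5)[OF g y(1)] by simp
  qed
  then have "restrict e (topspace Z) \<in> carrier (deck_group Z q)"
    using hom by (simp add: deck_group_iff)
  then show ?thesis
    using e(2) C(6) by (intro bexI[of _ "restrict e (topspace Z)"]) simp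
qed

text \<open>\<open>e \<circ> f\<close> and \<open>f \<circ> g\<close> are both lifts of
  \<open>p\<close> along \<open>q\<close>. It is therefore enough to match \<open>e\<close> and
  \<open>g\<close> at one base point.\<close>

lemma equivariant_if_agree:
  assumes Y: "connected_space Y" and c: "(Z, q, f) \<in> intermediate_covers Y X p"
    and e: "e \<in> carrier (deck_group Z q)" and g: "g \<in> carrier (deck_group Y p)"
    and y0: "y0 \<in> topspace Y" "e (f y0) = f (g y0)" and y: "y \<in> topspace Y"
  shows "e (f y) = f (g y)"
proof -
  note C = intermediate_coversD[OF c]
  show ?thesis
  proof (rule lifts_eq[of Z X q Y "\<lambda>y. e (f y)" "\<lambda>y. f (g y)", OF C(3) Y _ _ _ y0 y])
    show "continuous_map Y Z (\<lambda>y. e (f y))" "continuous_map Y Z (\<lambda>y. f (g y))"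
      using continuous_map_compose[OF C(4) deckD(2)[OF e]] continuous_map_compose[OF deckD(2)[OF g] C(4)]
      by (simp_all add: comp_def)
    show "q (e (f y)) = q (f (g y))" if "y \<in> topspace Y" for y
      using C(5,6) that deckD(5)[OF e C(6)[OF that]] deckD(4,5)[OF g that] by simp
  qed
qed

text \<open>Transitivity on the fibres of \<open>q\<close> yields an \<open>e\<close> taking
  \<open>f y0\<close> to \<open>f (g y0)\<close>; agreement at \<open>y0\<close> then spreads to all
  of \<open>Y\<close>.\<close>

lemma deck_descends_if_galois:
  assumes p: "galois_cover Y X p" and c: "(Z, q, f) \<in> intermediate_covers Y X p"
    and q: "galois_cover Z X q" and g: "g \<in> carrier (deck_group Y p)"
  shows "\<exists>e\<in>carrier (deck_group Z q). \<forall>y\<in>topspace Y. e (f y) = f (g y)"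
proof (cases "topspace Y = {}")
  case True
  then show ?thesis using monoid.one_closed[OF group.is_monoid[OF group_deck_group]] by blast
next
  case False
  then obtain y0 where y0: "y0 \<in> topspace Y" by blast
  note C = intermediate_coversD[OF c]
  have gy: "g y0 \<in> topspace Y" "p (g y0) = p y0" using deckD(4,5)[OF g y0] by auto
  then have "q (f y0) = q (f (g y0))" using C(5) y0 by simp
  then obtain e where e: "e \<in> carrier (deck_group Z q)" "f (g y0) = e (f y0)"
    using galois_coverD(4)[OF q C(6)[OF y0] C(6)[OF gy(1)]] by blast
  then show ?thesis
    using equivariant_if_agree[OF galois_coverD(2)[OF p] c e(1) g y0] by force
qed

text \<open>The converse direction to descent, with transitivity on the fibres of \<open>p\<close>
  supplying \<open>g\<close>. It gives surjectivity of the homomorphism from the deck group of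
  \<open>p\<close> to that of \<open>q\<close>.\<close>

lemma deck_lifts:
  assumes p: "galois_cover Y X p" and c: "(Z, q, f) \<in> intermediate_covers Y X p"
    and surj: "f ` topspace Y = topspace Z" and e: "e \<in> carrier (deck_group Z q)"
  shows "\<exists>g\<in>carrier (deck_group Y p). \<forall>y\<in>topspace Y. e (f y) = f (g y)"
proof (cases "topspace Y = {}")
  case True
  then show ?thesis using monoid.one_closed[OF group.is_monoid[OF group_deck_group]] by blast
next
  case False
  then obtain y0 where y0: "y0 \<in> topspace Y" by blast
  note C = intermediate_coversD[OF c]
  have ez: "e (f y0) \<in> topspace Z" "q (e (f y0)) = q (f y0)" using deckD(4,5)[OF e C(6)[OF y0]] by auto
  then obtain y1 where y1: "y1 \<in> topspace Y" "e (f y0) = f y1" using surj by force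
  then have "p y0 = p y1" using C(5) ez(2) y0 by simp
  then obtain g where g: "g \<in> carrier (deck_group Y p)" "y1 = g y0"
    using galois_coverD(4)[OF p y0 y1(1)] by blast
  then show ?thesis
    using equivariant_if_agree[OF galois_coverD(2)[OF p] c e g(1) y0] y1(2) by blast
qed

text \<open>Whether every deck transformation of \<open>p\<close> descends to one of \<open>q\<close> is the link between the two
  conditions: it holds if \<open>carrier (deck_group Y f)\<close> is normal and it holds if \<open>q\<close> is Galois, and
  it implies both as well as the description of \<open>deck_group Z q\<close>.\<close>

context
  fixes X :: "'x topology" and Y :: "'y topology" and Z :: "'z topology"
    and p :: "'y \<Rightarrow> 'x" and q :: "'z \<Rightarrow> 'x" and f :: "'y \<Rightarrow> 'z"
  assumes p: "galois_cover Y X p" and c: "(Z, q, f) \<in> intermediate_covers Y X p"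
    and surj: "f ` topspace Y = topspace Z"
    and descends: "\<And>g. g \<in> carrier (deck_group Y p) \<Longrightarrow>
      \<exists>e\<in>carrier (deck_group Z q). \<forall>y\<in>topspace Y. e (f y) = f (g y)"
begin

text \<open>If \<open>g\<close> descends to \<open>e\<close>, then applying \<open>f\<close> after
  \<open>g\<close> is the same as applying \<open>e\<close> after \<open>f\<close>. The factor
  \<open>h\<close> is absorbed by \<open>f\<close>, and \<open>e\<close> then undoes the effect of
  the inverse of \<open>g\<close>.\<close>

lemma deck_group_normal_if_descends: "carrier (deck_group Y f) \<lhd> deck_group Y p"
proof -
  interpret group "deck_group Y p" by (rule group_deck_group)
  note C = intermediate_coversD[OF c]
  have H: "subgroup (carrier (deck_group Y f)) (deck_group Y p)"
    using subgroup_deck_group_factor[of Y q f p] C(5) by blast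
  have "g \<otimes>\<^bsub>deck_group Y p\<^esub> h \<otimes>\<^bsub>deck_group Y p\<^esub> inv\<^bsub>deck_group Y p\<^esub> g \<in> carrier (deck_group Y f)"
    if g: "g \<in> carrier (deck_group Y p)" and h: "h \<in> carrier (deck_group Y f)" for g h
  proof -
    let ?i = "inv\<^bsub>deck_group Y p\<^esub> g"
    let ?k = "g \<otimes>\<^bsub>deck_group Y p\<^esub> h \<otimes>\<^bsub>deck_group Y p\<^esub> ?i"
    have hG: "h \<in> carrier (deck_group Y p)" using subgroup.mem_carrier[OF H h] .
    have iG: "?i \<in> carrier (deck_group Y p)" using inv_closed[OF g] .
    have kG: "?k \<in> carrier (deck_group Y p)" using g hG iG by simp
    obtain e where e: "\<forall>y\<in>topspace Y. e (f y) = f (g y)" using descends[OF g] by blast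
    have "f (?k y) = f y" if y: "y \<in> topspace Y" for y
    proof -
      have iy: "?i y \<in> topspace Y" using deckD(4)[OF iG y] .
      have "f (?k y) = f (g (h (?i y)))"
        using g hG iG y iy by (simp add: deck_mult_apply)
      also have "\<dots> = e (f (h (?i y)))" using e deckD(4)[OF h iy] by simp
      also have "\<dots> = e (f (?i y))" using deckD(5)[OF h iy] by simp
      also have "\<dots> = f y" using e iy deck_inv_apply(2)[OF g y] by simp
      finally show ?thesis .
    qed
    then show ?thesis using kG by (simp add: deck_group_iff)
  qed
  then show ?thesis using H by (simp add: normal_inv_iff)
qed

lemma galois_cover_if_descends: "galois_cover Z X q"
  unfolding galois_cover_iff
proof (intro conjI ballI impI)
  note P = galois_coverD[OF p] and C = intermediate_coversD[OF c]
  show "covering_map Z X q" "connected_space Z" by (rule C(3), rule C(2))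
  have "q ` f ` topspace Y = p ` topspace Y" using C(5) by (auto simp: image_image)
  then show "q ` topspace Z = topspace X" using P(3) surj by simp
  fix z z' assume z: "z \<in> topspace Z" "z' \<in> topspace Z" "q z = q z'"
  then obtain y y' where y: "y \<in> topspace Y" "z = f y" "y' \<in> topspace Y" "z' = f y'"
    using surj by blast
  then have "p y = p y'" using z(3) C(5) by simp
  then obtain g where g: "g \<in> carrier (deck_group Y p)" "y' = g y" using P(4) y by blast
  obtain e where e: "e \<in> carrier (deck_group Z q)" "\<forall>y\<in>topspace Y. e (f y) = f (g y)"
    using descends[OF g(1)] by blast
  then have "z' = e z" using g(2) y by simp
  then show "\<exists>d\<in>carrier (deck_group Z q). z' = d z" using e(1) by blast
qed

text \<open>First isomorphism theorem for the map sending \<open>g\<close> to the transformation of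
  \<open>Z\<close> it descends to; its kernel consists of the \<open>g\<close> that preserve
  \<open>f\<close>.\<close>

lemma deck_group_iso_if_descends: "deck_group Z q \<cong> deck_group Y p Mod carrier (deck_group Y f)"
proof -
  let ?G = "deck_group Y p" and ?D = "deck_group Z q"
  interpret G: group ?G by (rule group_deck_group)
  interpret D: group ?D by (rule group_deck_group)
  note C = intermediate_coversD[OF c]
  \<comment> \<open>As \<open>f\<close> is onto, an element of the deck group of \<open>q\<close> is
    determined by its composite with \<open>f\<close>. So the choice of \<open>\<Phi>\<close> is
    forced, and it is multiplicative.\<close>
  have unique: "d = e"
    if "d \<in> carrier ?D" "e \<in> carrier ?D" "\<forall>y\<in>topspace Y. d (f y) = e (f y)" for d e
  proof (rule deck_eqI[OF that(1,2)])
    fix z assume "z \<in> topspace Z"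
    then obtain y where "y \<in> topspace Y" "z = f y" using surj by blast
    then show "d z = e z" using that(3) by blast
  qed
  obtain \<Phi> where \<Phi>: "\<And>g. g \<in> carrier ?G \<Longrightarrow> \<Phi> g \<in> carrier ?D"
      "\<And>g y. \<lbrakk>g \<in> carrier ?G; y \<in> topspace Y\<rbrakk> \<Longrightarrow> \<Phi> g (f y) = f (g y)"
    using descends by metis
  have hom: "\<Phi> \<in> hom ?G ?D"
  proof (rule homI)
    fix g h assume g: "g \<in> carrier ?G" and h: "h \<in> carrier ?G"
    show "\<Phi> (g \<otimes>\<^bsub>?G\<^esub> h) = \<Phi> g \<otimes>\<^bsub>?D\<^esub> \<Phi> h"
      by (rule unique)
        (use g h \<Phi> C(6) deckD(4)[OF h] in \<open>simp_all add: deck_mult_apply\<close>)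
  qed (rule \<Phi>(1))
  interpret group_hom ?G ?D \<Phi>
    using hom by (intro group_hom.intro group_hom_axioms.intro G.group_axioms D.group_axioms)
  have "\<Phi> ` carrier ?G = carrier ?D"
  proof
    show "carrier ?D \<subseteq> \<Phi> ` carrier ?G"
    proof
      fix e assume e: "e \<in> carrier ?D"
      obtain g where g: "g \<in> carrier ?G" "\<forall>y\<in>topspace Y. e (f y) = f (g y)"
        using deck_lifts[OF p c surj e] by blast
      then have "e = \<Phi> g" using unique[OF e \<Phi>(1)] \<Phi>(2) by simp
      then show "e \<in> \<Phi> ` carrier ?G" using g(1) by blast
    qed
  qed (use \<Phi>(1) in blast)
  moreover have "kernel ?G ?D \<Phi> = carrier (deck_group Y f)"
  proof -
    have "\<Phi> g = \<one>\<^bsub>?D\<^esub> \<longleftrightarrow> (\<forall>y\<in>topspace Y. f (g y) = f y)" if g: "g \<in> carrier ?G" for g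
    proof
      assume "\<Phi> g = \<one>\<^bsub>?D\<^esub>"
      then show "\<forall>y\<in>topspace Y. f (g y) = f y"
        using \<Phi>(2)[OF g] C(6) deck_one_apply by metis
    next
      assume "\<forall>y\<in>topspace Y. f (g y) = f y"
      then show "\<Phi> g = \<one>\<^bsub>?D\<^esub>"
        by (intro unique \<Phi>(1) g D.one_closed) (simp add: \<Phi>(2)[OF g] C(6) deck_one_apply)
    qed
    moreover have "carrier (deck_group Y f) \<subseteq> carrier ?G"
      using subgroup.subset[OF subgroup_deck_group_factor[of Y q f p]] C(5) by blast
    ultimately show ?thesis by (auto simp: kernel_def deck_group_iff)
  qed
  ultimately have "?G Mod carrier (deck_group Y f) \<cong> ?D" using FactGroup_iso by simp
  \<comment> \<open>Reversing the isomorphism requires the quotient to be a group, which is where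
    normality enters.\<close>
  then show ?thesis
    using group.iso_sym normal.factorgroup_is_group[OF deck_group_normal_if_descends] by blast
qed

end

section \<open>The correspondence between subgroups and intermediate covers\<close>

theorem theorem1p2p19:
  fixes X :: "'x topology" and Y :: "'y topology" and p :: "'y \<Rightarrow> 'x"
    and G :: "('y \<Rightarrow> 'y) monoid"
  assumes "admissible_space X" and "admissible_space Y"
    and "connected_space X"
    and "galois_cover Y X p"
    and G: "G = deck_group Y p"
  shows
    "(\<forall>(Z :: 'z topology) q f. (Z, q, f) \<in> intermediate_covers Y X p \<longrightarrow>
        galois_cover Y Z f \<and>
        subgroup (carrier (deck_group Y f)) G \<and>
        iso_intermediate Y (Z, q, f) (quotient_cover Y p (carrier (deck_group Y f)))) \<and>
     (\<forall>H. subgroup H G \<longrightarrow>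
        quotient_cover Y p H \<in> intermediate_covers Y X p \<and>
        Aut_over Y (quotient_cover Y p H) = H) \<and>
     (\<forall>(c :: 'z topology \<times> ('z \<Rightarrow> 'x) \<times> ('y \<Rightarrow> 'z)) \<in> intermediate_covers Y X p.
      \<forall>(c' :: 'w topology \<times> ('w \<Rightarrow> 'x) \<times> ('y \<Rightarrow> 'w)) \<in> intermediate_covers Y X p.
        iso_intermediate Y c c' \<longleftrightarrow> Aut_over Y c = Aut_over Y c') \<and>
     bij_betw (\<lambda>H. iso_rel Y X p `` {quotient_cover Y p H})
       {H. subgroup H G} (intermediate_covers Y X p // iso_rel Y X p) \<and>
     Aut_over Y respects (iso_rel Y X p :: (('y set topology \<times> ('y set \<Rightarrow> 'x) \<times> ('y \<Rightarrow> 'y set)) \<times> _) set) \<and>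
     bij_betw (\<lambda>C :: ('y set topology \<times> ('y set \<Rightarrow> 'x) \<times> ('y \<Rightarrow> 'y set)) set.
         the_elem (Aut_over Y ` C))
       (intermediate_covers Y X p // iso_rel Y X p) {H. subgroup H G} \<and>
     (\<forall>H. subgroup H G \<longrightarrow>
        the_elem (Aut_over Y ` (iso_rel Y X p `` {quotient_cover Y p H})) = H) \<and>
     (\<forall>(Z :: 'z topology) q f. (Z, q, f) \<in> intermediate_covers Y X p \<longrightarrow>
        (galois_cover Z X q \<longleftrightarrow> carrier (deck_group Y f) \<lhd> G) \<and>
        (galois_cover Z X q \<longrightarrow> deck_group Z q \<cong> G Mod carrier (deck_group Y f)))"
proof -
  have X: "locally_path_connected_space X" using \<open>admissible_space X\<close> by (simp add: admissible_space_def)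
  note Y = \<open>admissible_space Y\<close> and p = \<open>galois_cover Y X p\<close>
  let ?\<Q> = "\<lambda>H. iso_rel Y X p `` {quotient_cover Y p H}"
  let ?\<A> = "\<lambda>C :: ('y set topology \<times> ('y set \<Rightarrow> 'x) \<times> ('y \<Rightarrow> 'y set)) set. the_elem (Aut_over Y ` C)"
  \<comment> \<open>Classes are formed among covers with points of type \<open>'y set\<close>, where
    the quotient covers live. An intermediate cover with points of any other type is isomorphic to
    one of these.\<close>
  let ?classes = "(intermediate_covers Y X p // iso_rel Y X p) ::
    ('y set topology \<times> ('y set \<Rightarrow> 'x) \<times> ('y \<Rightarrow> 'y set)) set set"
  note quot = quotient_cover_intermediate[OF X Y p] and Aut = Aut_over_quotient_cover[OF p]
  \<comment> \<open>\<open>AQ\<close> and \<open>QA\<close> make the two maps mutually inverse, and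
    \<open>A\<close> and \<open>Q\<close> check that they land in the right sets; both bijections
    follow from these four facts.\<close>
  have AQ: "?\<A> (?\<Q> H) = H" if "subgroup H (deck_group Y p)" for H
    using the_elem_Aut_over_class[OF quot[OF that]] Aut[OF that] by simp
  have QA: "?\<Q> (?\<A> C) = C" and A: "subgroup (?\<A> C) (deck_group Y p)" if C: "C \<in> ?classes" for C
  proof -
    obtain c where c: "c \<in> intermediate_covers Y X p" "C = iso_rel Y X p `` {c}"
      using C by (rule quotientE)
    then have AC: "?\<A> C = Aut_over Y c" using the_elem_Aut_over_class by simp
    show "?\<Q> (?\<A> C) = C" using quotient_cover_Aut_over_class[OF X Y p c(1)] AC c(2) by simp
    show "subgroup (?\<A> C) (deck_group Y p)" using subgroup_Aut_over[OF c(1)] AC by simp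
  qed
  have Q: "?\<Q> H \<in> ?classes" if "subgroup H (deck_group Y p)" for H
    using quot[OF that] by (rule quotientI)
  have bij1: "bij_betw ?\<Q> {H. subgroup H G} ?classes"
    unfolding G by (rule bij_betw_byWitness[where f' = ?\<A>]) (use AQ QA A Q in auto)
  have bij2: "bij_betw ?\<A> ?classes {H. subgroup H G}"
    unfolding G by (rule bij_betw_byWitness[where f' = ?\<Q>]) (use AQ QA A Q in auto)
  have resp: "Aut_over Y respects
      (iso_rel Y X p :: (('y set topology \<times> ('y set \<Rightarrow> 'x) \<times> ('y \<Rightarrow> 'y set)) \<times> _) set)"
    by (rule congruentI, rule Aut_over_eq_if_iso[where X = X and p = p]) (simp_all add: iso_rel_def)
  have part1: "galois_cover Y Z f \<and> subgroup (carrier (deck_group Y f)) G \<and>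
      iso_intermediate Y (Z, q, f) (quotient_cover Y p (carrier (deck_group Y f)))"
    if c: "(Z, q, f) \<in> intermediate_covers Y X p" for Z :: "'z topology" and q f
  proof (intro conjI)
    show "galois_cover Y Z f" using galois_cover_intermediate[OF X p c] .
    show H: "subgroup (carrier (deck_group Y f)) G"
      using subgroup_Aut_over[OF c] by (simp add: Aut_over_def G)
    show "iso_intermediate Y (Z, q, f) (quotient_cover Y p (carrier (deck_group Y f)))"
      using iso_intermediate_commute[OF quot iso_quotient_cover_deck_group[OF X p c]] H G by simp
  qed
  have part2: "quotient_cover Y p H \<in> intermediate_covers Y X p \<and> Aut_over Y (quotient_cover Y p H) = H"
    if "subgroup H G" for H
    using quot Aut that G by blast
  have part4: "(galois_cover Z X q \<longleftrightarrow> carrier (deck_group Y f) \<lhd> G) \<and>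
      (galois_cover Z X q \<longrightarrow> deck_group Z q \<cong> G Mod carrier (deck_group Y f))"
    if c: "(Z, q, f) \<in> intermediate_covers Y X p" for Z :: "'z topology" and q f
  proof -
    have surj: "f ` topspace Y = topspace Z" using galois_coverD(3)[OF galois_cover_intermediate[OF X p c]] .
    have "galois_cover Z X q" if "carrier (deck_group Y f) \<lhd> G"
      using galois_cover_if_descends[OF p c surj deck_descends_if_normal[OF X p c]] that G by simp
    moreover have "carrier (deck_group Y f) \<lhd> G" "deck_group Z q \<cong> G Mod carrier (deck_group Y f)"
      if q: "galois_cover Z X q"
      using deck_group_normal_if_descends[OF p c surj deck_descends_if_galois[OF p c q]]
        deck_group_iso_if_descends[OF p c surj deck_descends_if_galois[OF p c q]] G by auto
    ultimately show ?thesis by blast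
  qed
  have part3: "\<forall>(c :: 'z topology \<times> ('z \<Rightarrow> 'x) \<times> ('y \<Rightarrow> 'z)) \<in> intermediate_covers Y X p.
      \<forall>(c' :: 'w topology \<times> ('w \<Rightarrow> 'x) \<times> ('y \<Rightarrow> 'w)) \<in> intermediate_covers Y X p.
        iso_intermediate Y c c' \<longleftrightarrow> Aut_over Y c = Aut_over Y c'"
    using iso_intermediate_iff_Aut_over_eq[OF X Y p] by (intro ballI)
  show ?thesis
    by (intro conjI) (use part1 part2 part4 AQ G bij1 bij2 in \<open>simp_all add: part3 resp\<close>)
qed

end
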